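(* Let $G$ be a free product of countably many groups, each of which is finite or isomorphic to $\mathbb{Z}$, and let $A$ be a finite abelian group. Then for every alphabet $\Sigma$, the restricted wreath product $A\wr G$ embeds as a subgroup of $\llbracket\Sigma^{\mathbb{Z}}\rrbracket$. In particular the lamplighter group $\mathbb{Z}_2\wr\mathbb{Z}$ embeds in $\llbracket\Sigma^{\mathbb{Z}}\rrbracket$.
   Context: An alphabet is a finite set with at least two elements. $\llbracket\Sigma^{\mathbb{Z}}\rrbracket$ is the group of homeomorphisms $f$ of $\Sigma^{\mathbb{Z}}$ with a continuous $c:\Sigma^{\mathbb{Z}}\to\mathbb{Z}$ such that $f(x)=\sigma^{c(x)}(x)$, where $\sigma(x)_i=x_{i+1}$. $A\wr G=\left(\bigoplus_G A\right)\rtimes G$ with $G$ acting by translation of coordinates. *)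

theory Defs
  imports "HOL-Analysis.Analysis" "HOL-Algebra.Algebra"
begin

definition reduced_word :: "'i set \<Rightarrow> ('i \<Rightarrow> ('g, 'm) monoid_scheme) \<Rightarrow> ('i \<times> 'g) list \<Rightarrow> bool" where
  "reduced_word I H w \<longleftrightarrow>
     (\<forall>(i, g) \<in> set w. i \<in> I \<and> g \<in> carrier (H i) \<and> g \<noteq> \<one>\<^bsub>H i\<^esub>) \<and>
     (\<forall>k. Suc k < length w \<longrightarrow> fst (w ! k) \<noteq> fst (w ! Suc k))"

fun cons_red :: "('i \<Rightarrow> ('g, 'm) monoid_scheme) \<Rightarrow> 'i \<times> 'g \<Rightarrow> ('i \<times> 'g) list \<Rightarrow> ('i \<times> 'g) list" where
  "cons_red H (i, g) [] = (if g = \<one>\<^bsub>H i\<^esub> then [] else [(i, g)])"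
| "cons_red H (i, g) ((j, h) # w) =
     (if g = \<one>\<^bsub>H i\<^esub> then (j, h) # w
      else if i = j then
        (let k = g \<otimes>\<^bsub>H i\<^esub> h in if k = \<one>\<^bsub>H i\<^esub> then w else (i, k) # w)
      else (i, g) # (j, h) # w)"

definition free_product :: "'i set \<Rightarrow> ('i \<Rightarrow> ('g, 'm) monoid_scheme) \<Rightarrow> ('i \<times> 'g) list monoid" where
  "free_product I H =
     \<lparr>carrier = {w. reduced_word I H w},
      monoid.mult = (\<lambda>w v. foldr (cons_red H) w v),
      one = []\<rparr>"

text \<open>A wr G = (finitely supported functions G -> A) semidirect G, with G acting by
left translation of coordinates: (g.f)(x) = f(g^-1 x).\<close>

definition wreath_product :: "('a, 'm) monoid_scheme \<Rightarrow> ('g, 'n) monoid_scheme \<Rightarrow> (('g \<Rightarrow> 'a) \<times> 'g) monoid" where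
  "wreath_product A G =
     \<lparr>carrier = {(f, g). g \<in> carrier G \<and> f \<in> carrier G \<rightarrow> carrier A
                       \<and> (\<forall>x. x \<notin> carrier G \<longrightarrow> f x = \<one>\<^bsub>A\<^esub>)
                       \<and> finite {x \<in> carrier G. f x \<noteq> \<one>\<^bsub>A\<^esub>}},
      monoid.mult = (\<lambda>(f, g) (f', g').
         ((\<lambda>x. if x \<in> carrier G then f x \<otimes>\<^bsub>A\<^esub> f' (inv\<^bsub>G\<^esub> g \<otimes>\<^bsub>G\<^esub> x) else \<one>\<^bsub>A\<^esub>),
          g \<otimes>\<^bsub>G\<^esub> g')),
      one = ((\<lambda>x. \<one>\<^bsub>A\<^esub>), \<one>\<^bsub>G\<^esub>)\<rparr>"

definition full_shift :: "'b set \<Rightarrow> (int \<Rightarrow> 'b) topology" where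
  "full_shift S = product_topology (\<lambda>_. discrete_topology S) UNIV"

definition shift_pow :: "int \<Rightarrow> (int \<Rightarrow> 'b) \<Rightarrow> (int \<Rightarrow> 'b)" where
  "shift_pow n x = (\<lambda>i. x (i + n))"

definition topological_full_group :: "'b set \<Rightarrow> ((int \<Rightarrow> 'b) \<Rightarrow> (int \<Rightarrow> 'b)) monoid" where
  "topological_full_group S =
     \<lparr>carrier = {f. f \<in> extensional (topspace (full_shift S))
                 \<and> homeomorphic_map (full_shift S) (full_shift S) f
                 \<and> (\<exists>c. continuous_map (full_shift S) (discrete_topology (UNIV :: int set)) c
                        \<and> (\<forall>x \<in> topspace (full_shift S). f x = shift_pow (c x) x))},
      monoid.mult = (\<lambda>f g. compose (topspace (full_shift S)) f g),
      one = (\<lambda>x \<in> topspace (full_shift S). x)\<rparr>"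

definition embeds_in :: "('a, 'm) monoid_scheme \<Rightarrow> ('b, 'n) monoid_scheme \<Rightarrow> bool" where
  "embeds_in G H \<longleftrightarrow> (\<exists>h. h \<in> hom G H \<and> inj_on h (carrier G))"

end

theory Submission
  imports Defs
begin

text \<open>Suppose that \<open>A\<close> and \<open>G\<close> act on the full shift by commuting elements of the topological full
  group, and that \<open>C\<close> is a clopen \<open>A\<close>-invariant set such that every finite nonempty \<open>F \<subseteq> G\<close> admits
  a point lying in exactly one of the translates \<open>h C\<close>, \<open>h \<in> F\<close>, and having a free \<open>A\<close>-orbit.  Then the
  lamp \<open>a\<close> at \<open>h\<close> may act as \<open>a\<close> on \<open>h C\<close> and trivially elsewhere, and \<open>A wr G\<close> embeds.

  To construct such actions, regard the shift as a head moving on an immutable tape.  The position of the head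
  inside a cell of the tape stores an element of \<open>A\<close>.  The factors of the free product act through marked
  blocks of cells, where the length of a block encodes a factor and an element \<open>h\<close> of it, chosen so that \<open>h\<close>
  moves the head from the left end to the right end.  A word of maximal length in \<open>F\<close> is spelled out as a
  chain of adjacent blocks: each letter crosses at most one block, so no other word of \<open>F\<close> takes the
  head from the left end of the chain to the right end.\<close>

section \<open>Maps that shift by a locally determined amount\<close>

text \<open>Elements of the full group cannot write on the tape, so lamp state and group element
  must both be encoded in the place of the head. Lamps displace the head inside a cell, the group
  displaces it by whole cells, and the patterns that steer the group are made of whole cells; hence
  neither action disturbs the other and they commute.

  The regular action on the labels of a finite pattern needs a finite group, so an infinite cyclic
  factor cannot act in this way. It is placed inside a free product of two groups of order two,
  where the product of the two involutions has infinite order. Infinitely many factors do no harm: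
  each reacts only to finitely many block lengths, all its own, so each letter acts locally although
  no radius serves all factors at once.

  No point with a free orbit under \<open>G\<close> is required. Faithfulness asks only, for each
  finite set of words, for one tape on which exactly one of them brings the head to two consecutive
  marks. Blocks of the chain have positive length, so within reach of the words such a pair occurs
  only at the end of the chain.\<close>

definition is_local :: "((int \<Rightarrow> 'b) \<Rightarrow> 'c) \<Rightarrow> bool" where
  "is_local d \<longleftrightarrow> (\<exists>R::int. \<forall>x y. (\<forall>i. \<bar>i\<bar> \<le> R \<longrightarrow> x i = y i) \<longrightarrow> d x = d y)"

text \<open>Boundedness of the displacement is not automatic, since the symbol type may be infinite;
  without it these maps would not be closed under composition.\<close>

definition shift_map :: "((int \<Rightarrow> 'b) \<Rightarrow> (int \<Rightarrow> 'b)) \<Rightarrow> bool" where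
  "shift_map f \<longleftrightarrow>
     (\<exists>c B. is_local c \<and> (\<forall>x. \<bar>c x\<bar> \<le> B) \<and> (\<forall>x. f x = shift_pow (c x) x))"

lemma shift_pow_0 [simp]: "shift_pow 0 x = x"
  by (simp add: shift_pow_def)

lemma shift_pow_shift_pow [simp]: "shift_pow m (shift_pow n x) = shift_pow (m + n) x"
  by (simp add: shift_pow_def algebra_simps)

lemma is_local_coord [simp]: "is_local (\<lambda>x. x t)"
  unfolding is_local_def by (rule exI[of _ "\<bar>t\<bar>"]) auto

lemma is_local_uniform:
  assumes "finite V" "\<And>v. v \<in> V \<Longrightarrow> is_local (c v)"
  shows "\<exists>R::int. \<forall>v\<in>V. \<forall>x y. (\<forall>i. \<bar>i\<bar> \<le> R \<longrightarrow> x i = y i) \<longrightarrow> c v x = c v y"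
  using assms
proof (induction V rule: finite_induct)
  case empty
  then show ?case by simp
next
  case (insert a V)
  obtain R where R: "\<forall>v\<in>V. \<forall>x y. (\<forall>i. \<bar>i\<bar> \<le> R \<longrightarrow> x i = y i) \<longrightarrow> c v x = c v y"
    using insert by blast
  obtain R' where "\<forall>x y. (\<forall>i. \<bar>i\<bar> \<le> R' \<longrightarrow> x i = y i) \<longrightarrow> c a x = c a y"
    using insert.prems[of a] by (auto simp: is_local_def)
  with R show ?case
    by (intro exI[of _ "max R R'"]) auto
qed

text \<open>Finitely many values of \<open>d\<close> give one radius common to all the
  \<open>c v\<close>. Within the larger of this radius and that of \<open>d\<close>, two agreeing
  sequences select the same \<open>c v\<close>.\<close>

lemma is_local_choice:
  assumes "is_local d" "\<And>x. d x \<in> V" "finite V" "\<And>v. v \<in> V \<Longrightarrow> is_local (c v)"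
  shows "is_local (\<lambda>x. c (d x) x)"
proof -
  obtain R where R: "\<forall>v\<in>V. \<forall>x y. (\<forall>i. \<bar>i\<bar> \<le> R \<longrightarrow> x i = y i) \<longrightarrow> c v x = c v y"
    by (rule exE[OF is_local_uniform[OF assms(3,4)]])
  obtain R' where R': "\<forall>x y. (\<forall>i. \<bar>i\<bar> \<le> R' \<longrightarrow> x i = y i) \<longrightarrow> d x = d y"
    using assms(1) by (auto simp: is_local_def)
  have "c (d x) x = c (d y) y" if "\<forall>i. \<bar>i\<bar> \<le> max R R' \<longrightarrow> x i = y i" for x y
  proof -
    have "d x = d y" using R' that by simp
    moreover have "c (d x) x = c (d x) y" using R assms(2) that by simp
    ultimately show ?thesis by simp
  qed
  then show ?thesis
    unfolding is_local_def by blast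
qed

lemma is_local_Collect:
  assumes "finite T" "\<And>t. t \<in> T \<Longrightarrow> is_local (P t)"
  shows "is_local (\<lambda>x. {t \<in> T. P t x})"
proof -
  obtain R where "\<forall>v\<in>T. \<forall>x y. (\<forall>i. \<bar>i\<bar> \<le> R \<longrightarrow> x i = y i) \<longrightarrow> P v x = P v y"
    by (rule exE[OF is_local_uniform[OF assms]])
  then show ?thesis
    unfolding is_local_def by (intro exI[of _ R] allI impI Collect_cong conj_cong refl) simp
qed

lemma is_local_comp:
  assumes "is_local d"
  shows "is_local (\<lambda>x. F (d x))"
proof -
  obtain R where R: "\<And>x y. (\<forall>i. \<bar>i\<bar> \<le> R \<longrightarrow> x i = y i) \<Longrightarrow> d x = d y"
    using assms unfolding is_local_def by blast
  show ?thesis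
    unfolding is_local_def by (intro exI[of _ R] allI impI arg_cong[of _ _ F] R) simp
qed

lemma is_local_Ball [intro]:
  assumes "finite T" "\<And>t. t \<in> T \<Longrightarrow> is_local (P t)"
  shows "is_local (\<lambda>x. \<forall>t\<in>T. P t x)"
proof -
  have "(\<lambda>x. \<forall>t\<in>T. P t x) = (\<lambda>x. {t \<in> T. P t x} = T)"
    by (auto simp: fun_eq_iff)
  then show ?thesis
    using is_local_comp[OF is_local_Collect[OF assms], where F = "\<lambda>A. A = T"] by simp
qed

lemma is_local_Bex [intro]:
  assumes "finite T" "\<And>t. t \<in> T \<Longrightarrow> is_local (P t)"
  shows "is_local (\<lambda>x. \<exists>t\<in>T. P t x)"
proof -
  have "(\<lambda>x. \<exists>t\<in>T. P t x) = (\<lambda>x. {t \<in> T. P t x} \<noteq> {})"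
    by (auto simp: fun_eq_iff)
  then show ?thesis
    using is_local_comp[OF is_local_Collect[OF assms], where F = "\<lambda>A. A \<noteq> {}"] by (simp only:)
qed

lemma is_local_comp2:
  assumes "is_local d" "is_local e"
  shows "is_local (\<lambda>x. F (d x) (e x))"
proof -
  obtain R R' where "\<forall>x y. (\<forall>i. \<bar>i\<bar> \<le> R \<longrightarrow> x i = y i) \<longrightarrow> d x = d y"
    "\<forall>x y. (\<forall>i. \<bar>i\<bar> \<le> R' \<longrightarrow> x i = y i) \<longrightarrow> e x = e y"
    using assms by (auto simp: is_local_def)
  then have "F (d x) (e x) = F (d y) (e y)" if "\<forall>i. \<bar>i\<bar> \<le> max R R' \<longrightarrow> x i = y i" for x y
    using that by (metis max.coboundedI1 max.coboundedI2)
  then show ?thesis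
    unfolding is_local_def by blast
qed

lemma is_local_conj [intro]: "is_local P \<Longrightarrow> is_local Q \<Longrightarrow> is_local (\<lambda>x. P x \<and> Q x)"
  by (rule is_local_comp2)

lemma is_local_not [intro]: "is_local P \<Longrightarrow> is_local (\<lambda>x. \<not> P x)"
  by (rule is_local_comp)

text \<open>The window of \<open>d\<close> at \<open>f x\<close> is a window of \<open>x\<close>
  displaced by at most \<open>B\<close>, which explains the radius \<open>R' + B\<close>.\<close>

lemma shift_map_local:
  assumes "shift_map f" "is_local d"
  shows "is_local (\<lambda>x. d (f x))"
proof -
  obtain c B where c: "is_local c" "\<And>x. \<bar>c x\<bar> \<le> B" "\<And>x. f x = shift_pow (c x) x"
    using assms(1) unfolding shift_map_def by blast
  obtain R where R: "\<And>x y. (\<forall>i. \<bar>i\<bar> \<le> R \<longrightarrow> x i = y i) \<Longrightarrow> c x = c y"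
    using c(1) unfolding is_local_def by blast
  obtain R' where R': "\<And>x y. (\<forall>i. \<bar>i\<bar> \<le> R' \<longrightarrow> x i = y i) \<Longrightarrow> d x = d y"
    using assms(2) unfolding is_local_def by blast
  show ?thesis
    unfolding is_local_def
  proof (intro exI allI impI)
    fix x y :: "int \<Rightarrow> 'a" assume xy: "\<forall>i. \<bar>i\<bar> \<le> max R (R' + B) \<longrightarrow> x i = y i"
    have e: "c x = c y" using xy by (intro R) simp
    have "x (i + c x) = y (i + c y)" if "\<bar>i\<bar> \<le> R'" for i
    proof -
      have "\<bar>i + c x\<bar> \<le> R' + B" using that c(2)[of x] by linarith
      then show ?thesis using xy e by auto
    qed
    then show "d (f x) = d (f y)"
      by (intro R') (simp add: c(3) shift_pow_def)
  qed
qed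

lemma shift_map_id [simp]: "shift_map (\<lambda>x. x)"
  unfolding shift_map_def is_local_def by (intro exI[of _ "\<lambda>_. 0"] exI[of _ 0]) simp

lemma shift_map_comp:
  assumes "shift_map f" "shift_map g"
  shows "shift_map (\<lambda>x. f (g x))"
proof -
  obtain c B where c: "is_local c" "\<And>x. \<bar>c x\<bar> \<le> B" "\<And>x. f x = shift_pow (c x) x"
    using assms(1) unfolding shift_map_def by blast
  obtain c' B' where c': "is_local c'" "\<And>x. \<bar>c' x\<bar> \<le> B'" "\<And>x. g x = shift_pow (c' x) x"
    using assms(2) unfolding shift_map_def by blast
  have "is_local (\<lambda>x. c (g x) + c' x)"
    by (rule is_local_comp2[OF shift_map_local[OF assms(2) c(1)] c'(1)])
  moreover have "\<bar>c (g x) + c' x\<bar> \<le> B + B'" for x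
    using c(2)[of "g x"] c'(2)[of x] by linarith
  moreover have "f (g x) = shift_pow (c (g x) + c' x) x" for x
    using c(3)[of "g x"] c'(3)[of x] by (metis shift_pow_shift_pow)
  ultimately show ?thesis
    unfolding shift_map_def
    by (intro exI[of _ "\<lambda>x. c (g x) + c' x"] exI[of _ "B + B'"]) blast
qed

text \<open>Lets data read off a bounded window select one of finitely many maps; lamps and pattern
  actions are both obtained in this way.\<close>

lemma shift_map_choice:
  assumes "is_local d" "\<And>x. d x \<in> V" "finite V" "\<And>v. v \<in> V \<Longrightarrow> shift_map (f v)"
  shows "shift_map (\<lambda>x. f (d x) x)"
proof -
  have "\<forall>v\<in>V. \<exists>cB. is_local (fst cB) \<and> (\<forall>x. \<bar>fst cB x\<bar> \<le> (snd cB :: int)) \<and> (\<forall>x. f v x = shift_pow (fst cB x) x)"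
    using assms(4) unfolding shift_map_def by fastforce
  then obtain cB where cB: "\<forall>v\<in>V. is_local (fst (cB v)) \<and> (\<forall>x. \<bar>fst (cB v) x\<bar> \<le> (snd (cB v) :: int)) \<and> (\<forall>x. f v x = shift_pow (fst (cB v) x) x)"
    by (rule bchoice[THEN exE])
  define c B where "c = (\<lambda>v. fst (cB v))" "B = (\<lambda>v. snd (cB v))"
  have c: "is_local (c v)" "\<bar>c v x\<bar> \<le> B v" "f v x = shift_pow (c v x) x" if "v \<in> V" for v x
    using cB that by (auto simp: c_B_def)
  have "is_local (\<lambda>x. c (d x) x)"
    by (rule is_local_choice[OF assms(1-3) c(1)])
  moreover have "\<bar>c (d x) x\<bar> \<le> Max (B ` V)" for x
    by (rule order_trans[OF c(2)[OF assms(2)] Max_ge]) (use assms(2,3) in auto)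
  moreover have "f (d x) x = shift_pow (c (d x) x) x" for x
    using c(3)[OF assms(2)] .
  ultimately show ?thesis
    unfolding shift_map_def by (intro exI[of _ "\<lambda>x. c (d x) x"] exI[of _ "Max (B ` V)"]) blast
qed

section \<open>Continuity, and passage to the topological full group\<close>

lemma topspace_full_shift: "x \<in> topspace (full_shift S) \<longleftrightarrow> (\<forall>i. x i \<in> S)"
  by (auto simp: full_shift_def)

lemma shift_map_topspace:
  "shift_map f \<Longrightarrow> x \<in> topspace (full_shift S) \<Longrightarrow> f x \<in> topspace (full_shift S)"
  by (auto simp: shift_map_def topspace_full_shift shift_pow_def)

text \<open>Freezing the coordinates in the window around \<open>x\<close> cuts out a basic open set
  of the product topology, on which \<open>d\<close> is constant.\<close>

lemma is_local_continuous:
  assumes "is_local d" "\<And>x. x \<in> topspace (full_shift S) \<Longrightarrow> d x \<in> U"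
  shows "continuous_map (full_shift S) (discrete_topology U) d"
proof -
  obtain R where R: "\<And>x y. (\<forall>i. \<bar>i\<bar> \<le> R \<longrightarrow> x i = y i) \<Longrightarrow> d x = d y"
    using assms(1) unfolding is_local_def by blast
  have "openin (full_shift S) {x \<in> topspace (full_shift S). d x \<in> V}" for V
  proof (subst openin_subopen, intro ballI)
    fix x assume x: "x \<in> {x \<in> topspace (full_shift S). d x \<in> V}"
    let ?W = "\<Pi>\<^sub>E i\<in>UNIV. if \<bar>i\<bar> \<le> R then {x i} else S"
    have "finite {i. (if \<bar>i\<bar> \<le> R then {x i} else S) \<noteq> topspace (discrete_topology S)}"
      by (rule finite_subset[of _ "{-R..R}"]) auto
    then have "openin (full_shift S) ?W"
      unfolding full_shift_def using x
      by (intro product_topology_basis) (auto simp: topspace_full_shift)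
    moreover have "x \<in> ?W" using x by (auto simp: topspace_full_shift)
    moreover have "?W \<subseteq> {x \<in> topspace (full_shift S). d x \<in> V}"
    proof
      fix y assume y: "y \<in> ?W"
      have "d y = d x"
        using y by (intro R) (auto simp: PiE_iff split: if_splits)
      moreover have "y i \<in> S" for i
        using y x by (cases "\<bar>i\<bar> \<le> R") (auto simp: PiE_iff topspace_full_shift dest!: spec[of _ i])
      ultimately show "y \<in> {x \<in> topspace (full_shift S). d x \<in> V}"
        using x by (auto simp: topspace_full_shift)
    qed
    ultimately show "\<exists>T. openin (full_shift S) T \<and> x \<in> T \<and> T \<subseteq> {x \<in> topspace (full_shift S). d x \<in> V}"
      by blast
  qed
  then show ?thesis
    using assms(2) by (auto simp: continuous_map_def Pi_iff)
qed

lemma shift_map_continuous: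
  assumes "shift_map f"
  shows "continuous_map (full_shift S) (full_shift S) f"
proof -
  have "continuous_map (full_shift S) (discrete_topology S) (\<lambda>x. f x k)" for k
    using shift_map_topspace[OF assms, of _ S]
    by (intro is_local_continuous shift_map_local[OF assms]) (auto simp: topspace_full_shift)
  then show ?thesis
    unfolding full_shift_def by (simp add: continuous_map_componentwise_UNIV)
qed

text \<open>Shift maps are total on all sequences over the symbol type, so their identities carry no
  side conditions; only here are they cut down to sequences over \<open>S\<close>.\<close>

lemma restrict_in_topological_full_group:
  assumes "shift_map f" "shift_map g" "\<And>x. f (g x) = x" "\<And>x. g (f x) = x"
  shows "restrict f (topspace (full_shift S)) \<in> carrier (topological_full_group S)"
proof -
  obtain c where c: "is_local c" "\<And>x. f x = shift_pow (c x) x"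
    using assms(1) unfolding shift_map_def by blast
  have "homeomorphic_maps (full_shift S) (full_shift S) f g"
    using assms by (auto simp: homeomorphic_maps_def shift_map_continuous)
  then have "homeomorphic_map (full_shift S) (full_shift S) (restrict f (topspace (full_shift S)))"
    using homeomorphic_map_eq[of "full_shift S" "full_shift S" f] homeomorphic_map_maps by fastforce
  moreover have "continuous_map (full_shift S) (discrete_topology UNIV) c"
    by (rule is_local_continuous[OF c(1)]) simp
  ultimately show ?thesis
    using c(2) by (auto simp: topological_full_group_def)
qed

text \<open>Inverses are requested as maps and not as images of inverse elements, so the wreath
  product enters only through its carrier and its multiplication.\<close>

lemma embeds_in_topological_full_groupI:
  fixes W :: "('w, 'm) monoid_scheme"
  assumes "\<And>w. w \<in> carrier W \<Longrightarrow> shift_map (\<Psi> w)"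
    and "\<And>w. w \<in> carrier W \<Longrightarrow> \<exists>g. shift_map g \<and> (\<forall>x. \<Psi> w (g x) = x) \<and> (\<forall>x. g (\<Psi> w x) = x)"
    and "\<And>v w x. v \<in> carrier W \<Longrightarrow> w \<in> carrier W \<Longrightarrow> \<Psi> (v \<otimes>\<^bsub>W\<^esub> w) x = \<Psi> v (\<Psi> w x)"
    and "\<And>v w. \<lbrakk>v \<in> carrier W; w \<in> carrier W; \<forall>x\<in>topspace (full_shift S). \<Psi> v x = \<Psi> w x\<rbrakk> \<Longrightarrow> v = w"
  shows "embeds_in W (topological_full_group S)"
  unfolding embeds_in_def
proof (intro exI conjI)
  let ?h = "\<lambda>w. restrict (\<Psi> w) (topspace (full_shift S))"
  show "?h \<in> hom W (topological_full_group S)"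
  proof (rule homI)
    show "?h w \<in> carrier (topological_full_group S)" if "w \<in> carrier W" for w
      using assms(1,2)[OF that] restrict_in_topological_full_group by metis
    show "?h (v \<otimes>\<^bsub>W\<^esub> w) = ?h v \<otimes>\<^bsub>topological_full_group S\<^esub> ?h w"
      if "v \<in> carrier W" "w \<in> carrier W" for v w
      using that assms(3) shift_map_topspace[OF assms(1)[OF that(2)], of _ S]
      by (auto simp: topological_full_group_def compose_def fun_eq_iff)
  qed
  show "inj_on ?h (carrier W)"
  proof (rule inj_onI)
    fix v w assume vw: "v \<in> carrier W" "w \<in> carrier W" "?h v = ?h w"
    have "\<Psi> v x = \<Psi> w x" if "x \<in> topspace (full_shift S)" for x
      using fun_cong[OF vw(3), of x] that by simp
    then show "v = w" using assms(4) vw by blast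
  qed
qed

section \<open>Wreath products from commuting actions\<close>

locale wreath_action = A: comm_group A + G: group G
  for A :: "('a, 'm) monoid_scheme" (structure) and G :: "('g, 'n) monoid_scheme" +
  fixes \<alpha> :: "'a \<Rightarrow> (int \<Rightarrow> 'b) \<Rightarrow> int \<Rightarrow> 'b" and \<phi> :: "'g \<Rightarrow> (int \<Rightarrow> 'b) \<Rightarrow> int \<Rightarrow> 'b"
    and C :: "(int \<Rightarrow> 'b) set" and S :: "'b set"
  assumes fin: "finite (carrier A)"
    and alpha_shift: "a \<in> carrier A \<Longrightarrow> shift_map (\<alpha> a)"
    and alpha_mult: "a \<in> carrier A \<Longrightarrow> b \<in> carrier A \<Longrightarrow> \<alpha> (a \<otimes> b) x = \<alpha> a (\<alpha> b x)"
    and alpha_one: "\<alpha> \<one> x = x"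
    and phi_shift: "g \<in> carrier G \<Longrightarrow> shift_map (\<phi> g)"
    and phi_mult: "g \<in> carrier G \<Longrightarrow> h \<in> carrier G \<Longrightarrow> \<phi> (g \<otimes>\<^bsub>G\<^esub> h) x = \<phi> g (\<phi> h x)"
    and phi_one: "\<phi> \<one>\<^bsub>G\<^esub> x = x"
    and comm: "a \<in> carrier A \<Longrightarrow> g \<in> carrier G \<Longrightarrow> \<phi> g (\<alpha> a x) = \<alpha> a (\<phi> g x)"
    and C_local: "is_local (\<lambda>x. x \<in> C)"
    and C_inv: "a \<in> carrier A \<Longrightarrow> x \<in> C \<Longrightarrow> \<alpha> a x \<in> C"
    and separate: "\<lbrakk>finite F; F \<subseteq> carrier G; F \<noteq> {}\<rbrakk> \<Longrightarrow>
      \<exists>x\<in>topspace (full_shift S). \<exists>h\<in>F. \<phi> (inv\<^bsub>G\<^esub> h) x \<in> C \<and>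
        (\<forall>k\<in>F. \<phi> (inv\<^bsub>G\<^esub> k) x \<in> C \<longrightarrow> k = h) \<and> (\<forall>a\<in>carrier A. \<alpha> a x = x \<longrightarrow> a = \<one>)"
begin

text \<open>Several translates of \<open>C\<close> may contain \<open>x\<close>; as \<open>A\<close>
  is commutative, their lamps combine into one element, and a whole configuration acts in one
  step.\<close>

definition lamp :: "('g \<Rightarrow> 'a) \<Rightarrow> (int \<Rightarrow> 'b) \<Rightarrow> 'a" where
  "lamp f x = finprod A f {h \<in> {h \<in> carrier G. f h \<noteq> \<one>}. \<phi> (inv\<^bsub>G\<^esub> h) x \<in> C}"

text \<open>The pair \<open>(f, g)\<close> is the product of \<open>f\<close> and \<open>g\<close>
  in this order, so the lamps are read after \<open>g\<close> has acted.\<close>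

definition wact :: "('g \<Rightarrow> 'a) \<times> 'g \<Rightarrow> (int \<Rightarrow> 'b) \<Rightarrow> int \<Rightarrow> 'b" where
  "wact = (\<lambda>(f, g) x. \<alpha> (lamp f (\<phi> g x)) (\<phi> g x))"

definition config :: "('g \<Rightarrow> 'a) \<Rightarrow> bool" where
  "config f \<longleftrightarrow> f \<in> carrier G \<rightarrow> carrier A \<and> (\<forall>x. x \<notin> carrier G \<longrightarrow> f x = \<one>)
     \<and> finite {x \<in> carrier G. f x \<noteq> \<one>}"

lemma carrier_wreath: "(f, g) \<in> carrier (wreath_product A G) \<longleftrightarrow> g \<in> carrier G \<and> config f"
  by (auto simp: wreath_product_def config_def)

lemma C_alpha_iff: "a \<in> carrier A \<Longrightarrow> \<alpha> a x \<in> C \<longleftrightarrow> x \<in> C"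
  using C_inv[of "inv a" "\<alpha> a x"] C_inv[of a x] alpha_mult[of "inv a" a x] alpha_one
  by auto

lemma phi_inv [simp]: "g \<in> carrier G \<Longrightarrow> \<phi> (inv\<^bsub>G\<^esub> g) (\<phi> g x) = x"
  "g \<in> carrier G \<Longrightarrow> \<phi> g (\<phi> (inv\<^bsub>G\<^esub> g) x) = x"
  using phi_mult[of "inv\<^bsub>G\<^esub> g" g x] phi_mult[of g "inv\<^bsub>G\<^esub> g" x] phi_one by auto

lemma alpha_inv [simp]: "a \<in> carrier A \<Longrightarrow> \<alpha> (inv a) (\<alpha> a x) = x"
  "a \<in> carrier A \<Longrightarrow> \<alpha> a (\<alpha> (inv a) x) = x"
  using alpha_mult[of "inv a" a x] alpha_mult[of a "inv a" x] alpha_one by auto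

lemma lamp_closed [simp]: "config f \<Longrightarrow> lamp f x \<in> carrier A"
  unfolding lamp_def by (rule A.finprod_closed) (auto simp: config_def)

text \<open>Every translate of \<open>C\<close> is \<open>A\<close>-invariant because
  \<open>\<phi>\<close> commutes with \<open>\<alpha>\<close>. Hence switching lamps never changes
  which lamps are seen, and successive configurations simply multiply.\<close>

lemma lamp_alpha [simp]: "a \<in> carrier A \<Longrightarrow> lamp f (\<alpha> a x) = lamp f x"
  unfolding lamp_def using C_alpha_iff comm
  by (intro arg_cong[of _ _ "finprod A f"]) auto

lemma config_closed: "config f \<Longrightarrow> f x \<in> carrier A"
  by (cases "x \<in> carrier G") (auto simp: config_def)

lemma lamp_superset:
  assumes "config f" "finite B" "{x \<in> carrier G. f x \<noteq> \<one>} \<subseteq> B" "B \<subseteq> carrier G"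
  shows "lamp f x = finprod A (\<lambda>h. if \<phi> (inv\<^bsub>G\<^esub> h) x \<in> C then f h else \<one>) B"
  unfolding lamp_def
  by (intro A.finprod_mono_neutral_cong_left) (use assms(2-4) config_closed[OF assms(1)] in auto)

lemma is_local_lamp: "config f \<Longrightarrow> is_local (lamp f)"
  unfolding lamp_def
  by (intro is_local_comp[where F = "finprod A f"] is_local_Collect shift_map_local[OF _ C_local] phi_shift)
    (auto simp: config_def)

lemma shift_map_lamp: "config f \<Longrightarrow> shift_map (\<lambda>x. \<alpha> (lamp f x) x)"
  by (rule shift_map_choice[where V = "carrier A"]) (auto simp: is_local_lamp fin alpha_shift)

lemma shift_map_inv_lamp: "config f \<Longrightarrow> shift_map (\<lambda>x. \<alpha> (inv (lamp f x)) x)"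
  by (rule shift_map_choice[where V = "carrier A"])
    (auto simp: is_local_comp[OF is_local_lamp, where F = "m_inv A"] fin alpha_shift)

text \<open>Commutativity of \<open>A\<close> splits the product over \<open>gB\<close>;
  substituting \<open>g h\<close> for \<open>h\<close> in the second part replaces \<open>u\<close>
  by its image under the inverse of \<open>g\<close>. This is the wreath multiplication seen from
  \<open>u\<close>.\<close>

lemma lamp_translate:
  assumes "config f" "config f'" "g \<in> carrier G"
  shows "lamp (\<lambda>x. if x \<in> carrier G then f x \<otimes> f' (inv\<^bsub>G\<^esub> g \<otimes>\<^bsub>G\<^esub> x) else \<one>) u
    = lamp f u \<otimes> lamp f' (\<phi> (inv\<^bsub>G\<^esub> g) u)" (is "lamp ?k u = _")
    and "config (\<lambda>x. if x \<in> carrier G then f x \<otimes> f' (inv\<^bsub>G\<^esub> g \<otimes>\<^bsub>G\<^esub> x) else \<one>)"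
proof -
  let ?sf = "{x \<in> carrier G. f x \<noteq> \<one>}" and ?sf' = "{x \<in> carrier G. f' x \<noteq> \<one>}"
  \<comment> \<open>\<open>B\<close> covers the support of \<open>f'\<close> while its translate
    \<open>gB\<close> covers the support of \<open>f\<close>.\<close>
  define B where "B = ?sf' \<union> (\<lambda>x. inv\<^bsub>G\<^esub> g \<otimes>\<^bsub>G\<^esub> x) ` ?sf"
  define gB where "gB = (\<lambda>x. g \<otimes>\<^bsub>G\<^esub> x) ` B"
  have B: "finite B" "?sf' \<subseteq> B" "B \<subseteq> carrier G"
    using assms by (auto simp: B_def config_def)
  have cancel: "g \<otimes>\<^bsub>G\<^esub> (inv\<^bsub>G\<^esub> g \<otimes>\<^bsub>G\<^esub> x) = x" "inv\<^bsub>G\<^esub> g \<otimes>\<^bsub>G\<^esub> (g \<otimes>\<^bsub>G\<^esub> x) = x"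
    if "x \<in> carrier G" for x
    using that assms(3) by (simp_all flip: G.m_assoc)
  have gB: "finite gB" "gB \<subseteq> carrier G" "?sf \<subseteq> gB"
  proof -
    show "finite gB" "gB \<subseteq> carrier G" using B assms(3) by (auto simp: gB_def)
    show "?sf \<subseteq> gB"
    proof
      fix x assume x: "x \<in> ?sf"
      then have "inv\<^bsub>G\<^esub> g \<otimes>\<^bsub>G\<^esub> x \<in> B" by (auto simp: B_def)
      then have "g \<otimes>\<^bsub>G\<^esub> (inv\<^bsub>G\<^esub> g \<otimes>\<^bsub>G\<^esub> x) \<in> gB" by (auto simp: gB_def)
      then show "x \<in> gB" using x cancel(1)[of x] by simp
    qed
  qed
  have cl: "f x \<in> carrier A" "f' x \<in> carrier A" for x
    using config_closed assms(1,2) by auto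
  have sk: "{x \<in> carrier G. ?k x \<noteq> \<one>} \<subseteq> gB"
  proof
    fix x assume x: "x \<in> {x \<in> carrier G. ?k x \<noteq> \<one>}"
    show "x \<in> gB"
    proof (cases "f x = \<one>")
      case True
      then have "inv\<^bsub>G\<^esub> g \<otimes>\<^bsub>G\<^esub> x \<in> B" using x cl assms(3) B(2) by auto
      then have "g \<otimes>\<^bsub>G\<^esub> (inv\<^bsub>G\<^esub> g \<otimes>\<^bsub>G\<^esub> x) \<in> gB" by (auto simp: gB_def)
      then show "x \<in> gB" using x cancel(1)[of x] by simp
    qed (use x gB in auto)
  qed
  show k: "config ?k"
    using finite_subset[OF sk gB(1)] cl by (auto simp: config_def)
  let ?P = "\<lambda>h. \<phi> (inv\<^bsub>G\<^esub> h) u \<in> C"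
  have "lamp ?k u = finprod A (\<lambda>h. (if ?P h then f h else \<one>) \<otimes>
      (if ?P h then f' (inv\<^bsub>G\<^esub> g \<otimes>\<^bsub>G\<^esub> h) else \<one>)) gB"
    unfolding lamp_superset[OF k gB(1) sk gB(2)] using gB(2) cl
    by (intro A.finprod_cong') auto
  also have "\<dots> = lamp f u \<otimes> finprod A (\<lambda>h. if ?P h then f' (inv\<^bsub>G\<^esub> g \<otimes>\<^bsub>G\<^esub> h) else \<one>) gB"
    unfolding lamp_superset[OF assms(1) gB(1,3,2)] using cl
    by (intro A.finprod_multf) auto
  also have "finprod A (\<lambda>h. if ?P h then f' (inv\<^bsub>G\<^esub> g \<otimes>\<^bsub>G\<^esub> h) else \<one>) gB
      = finprod A (\<lambda>h. if ?P (g \<otimes>\<^bsub>G\<^esub> h) then f' (inv\<^bsub>G\<^esub> g \<otimes>\<^bsub>G\<^esub> (g \<otimes>\<^bsub>G\<^esub> h)) else \<one>) B"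
    unfolding gB_def using cl B(3) assms(3)
    by (intro A.finprod_reindex) (auto intro!: inj_onI simp: subset_iff)
  also have "\<dots> = lamp f' (\<phi> (inv\<^bsub>G\<^esub> g) u)"
    unfolding lamp_superset[OF assms(2) B] using cl B(3) assms(3) cancel(2)
    by (intro A.finprod_cong') (auto simp: subset_iff G.inv_mult_group phi_mult)
  finally show "lamp ?k u = lamp f u \<otimes> lamp f' (\<phi> (inv\<^bsub>G\<^esub> g) u)" .
qed

lemma wact_mult:
  assumes "v \<in> carrier (wreath_product A G)" "w \<in> carrier (wreath_product A G)"
  shows "wact (v \<otimes>\<^bsub>wreath_product A G\<^esub> w) x = wact v (wact w x)"
proof -
  obtain f g f' g' where vw: "v = (f, g)" "w = (f', g')" "config f" "config f'"
    "g \<in> carrier G" "g' \<in> carrier G"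
    using assms carrier_wreath by (cases v; cases w) auto
  then show ?thesis
    by (simp add: wreath_product_def wact_def lamp_translate(1) phi_mult comm alpha_mult)
qed

lemma wact_shift:
  assumes "w \<in> carrier (wreath_product A G)"
  shows "shift_map (wact w)"
    and "\<exists>k. shift_map k \<and> (\<forall>x. wact w (k x) = x) \<and> (\<forall>x. k (wact w x) = x)"
proof -
  obtain f g where w: "w = (f, g)" "config f" "g \<in> carrier G"
    using assms carrier_wreath by (cases w) auto
  show "shift_map (wact w)"
    unfolding w wact_def using shift_map_comp[OF shift_map_lamp[OF w(2)] phi_shift[OF w(3)]] by simp
  have "shift_map (\<lambda>x. \<phi> (inv\<^bsub>G\<^esub> g) (\<alpha> (inv (lamp f x)) x))"
    using w by (intro shift_map_comp[OF phi_shift shift_map_inv_lamp]) auto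
  then show "\<exists>k. shift_map k \<and> (\<forall>x. wact w (k x) = x) \<and> (\<forall>x. k (wact w x) = x)"
    using w by (intro exI[of _ "\<lambda>x. \<phi> (inv\<^bsub>G\<^esub> g) (\<alpha> (inv (lamp f x)) x)"]) (auto simp: wact_def)
qed

lemma wact_inj:
  assumes "v \<in> carrier (wreath_product A G)" "w \<in> carrier (wreath_product A G)"
    and eq: "\<forall>x\<in>topspace (full_shift S). wact v x = wact w x"
  shows "v = w"
proof -
  obtain f g f' g' where vw: "v = (f, g)" "w = (f', g')" and f: "config f" "config f'"
    and g: "g \<in> carrier G" "g' \<in> carrier G"
    using assms carrier_wreath by (cases v; cases w) auto
  have eq': "\<alpha> (lamp f (\<phi> g x)) (\<phi> g x) = \<alpha> (lamp f' (\<phi> g' x)) (\<phi> g' x)"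
    if "x \<in> topspace (full_shift S)" for x
    using eq that by (auto simp: vw wact_def)
  have "g = g'"
  proof -
    \<comment> \<open>For \<open>h = inv g\<close> the point \<open>\<phi> (inv h) x\<close> is
      \<open>\<phi> g x\<close>. Lamps preserve \<open>C\<close> and its complement, so equal images
      force both group parts to send \<open>x\<close> into \<open>C\<close> or both not.\<close>
    let ?F = "{inv\<^bsub>G\<^esub> g, inv\<^bsub>G\<^esub> g'}"
    have "finite ?F" "?F \<subseteq> carrier G" "?F \<noteq> {}" using g by auto
    from separate[OF this] obtain x h where x: "x \<in> topspace (full_shift S)" "h \<in> ?F"
      "\<phi> (inv\<^bsub>G\<^esub> h) x \<in> C" "\<forall>k\<in>?F. \<phi> (inv\<^bsub>G\<^esub> k) x \<in> C \<longrightarrow> k = h"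
      by blast
    have "\<phi> g x \<in> C \<longleftrightarrow> \<phi> g' x \<in> C"
      using eq'[OF x(1)] C_alpha_iff lamp_closed f by metis
    then have "inv\<^bsub>G\<^esub> g = inv\<^bsub>G\<^esub> g'"
      using x(2-4) g by auto
    then show ?thesis using g G.inv_inv by metis
  qed
  moreover have "f = f'"
  proof (rule ccontr)
    assume "f \<noteq> f'"
    let ?s = "{x \<in> carrier G. f x \<noteq> \<one>}" and ?s' = "{x \<in> carrier G. f' x \<noteq> \<one>}"
    \<comment> \<open>Off \<open>F\<close> the configurations agree, and within \<open>F\<close>
      only \<open>h\<close> contributes at the separating point, so the two lamp values differ only
      in the factor at \<open>h\<close>.\<close>
    define F where "F = {h \<in> carrier G. f h \<noteq> f' h}"
    obtain z where "f z \<noteq> f' z" using \<open>f \<noteq> f'\<close> by auto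
    moreover from this have "z \<in> carrier G" using f unfolding config_def by metis
    ultimately have "F \<noteq> {}" by (auto simp: F_def)
    moreover have "F \<subseteq> ?s \<union> ?s'" by (auto simp: F_def)
    moreover have finB: "finite (?s \<union> ?s')" using f by (auto simp: config_def)
    moreover have "F \<subseteq> carrier G" by (auto simp: F_def)
    ultimately have "finite F" "F \<subseteq> carrier G" "F \<noteq> {}"
      using finite_subset by auto
    from separate[OF this] obtain u h where u: "u \<in> topspace (full_shift S)" "h \<in> F" "\<phi> (inv\<^bsub>G\<^esub> h) u \<in> C"
      "\<forall>k\<in>F. \<phi> (inv\<^bsub>G\<^esub> k) u \<in> C \<longrightarrow> k = h" "\<forall>a\<in>carrier A. \<alpha> a u = u \<longrightarrow> a = \<one>"
      by blast
    \<comment> \<open>Starting from the preimage of \<open>u\<close> under \<open>\<phi> g\<close>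
      makes both sides read their lamps at \<open>u\<close>.\<close>
    have "\<alpha> (lamp f u) u = \<alpha> (lamp f' u) u"
      using eq'[of "\<phi> (inv\<^bsub>G\<^esub> g) u"] shift_map_topspace[OF phi_shift u(1)] g \<open>g = g'\<close> by simp
    then have "\<alpha> (inv (lamp f' u) \<otimes> lamp f u) u = u"
      using f by (simp add: alpha_mult)
    then have "inv (lamp f' u) \<otimes> lamp f u = \<one>" using u(5) f by auto
    then have l: "lamp f u = lamp f' u"
      using A.inv_unique'[of "inv (lamp f' u)" "lamp f u"] f by (simp add: A.m_comm)
    have cl: "f x \<in> carrier A" "f' x \<in> carrier A" for x
      using config_closed f by auto
    let ?B = "?s \<union> ?s'"
    let ?r = "\<lambda>f h. if \<phi> (inv\<^bsub>G\<^esub> h) u \<in> C then f h else \<one>"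
    have hB: "h \<in> ?B" using u(2) by (auto simp: F_def)
    have "lamp f u = finprod A (?r f) (insert h (?B - {h}))"
      using hB finB by (subst lamp_superset[OF f(1), of ?B]) (auto simp: insert_absorb)
    also have "\<dots> = f h \<otimes> finprod A (?r f) (?B - {h})"
      using finB cl u(3) by (subst A.finprod_insert) auto
    also have "finprod A (?r f) (?B - {h}) = finprod A (?r f') (?B - {h})"
      using u(4) cl by (intro A.finprod_cong') (auto simp: F_def)
    finally have 1: "lamp f u = f h \<otimes> finprod A (?r f') (?B - {h})" .
    have "lamp f' u = finprod A (?r f') (insert h (?B - {h}))"
      using hB finB by (subst lamp_superset[OF f(2), of ?B]) (auto simp: insert_absorb)
    also have "\<dots> = f' h \<otimes> finprod A (?r f') (?B - {h})"
      using finB cl u(3) by (subst A.finprod_insert) auto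
    finally have "f h \<otimes> finprod A (?r f') (?B - {h}) = f' h \<otimes> finprod A (?r f') (?B - {h})"
      using 1 l by simp
    moreover have "finprod A (?r f') (?B - {h}) \<in> carrier A"
      using cl by (intro A.finprod_closed) auto
    ultimately have "f h = f' h" using cl A.right_cancel by blast
    then show False using u(2) by (simp add: F_def)
  qed
  ultimately show ?thesis by (simp add: vw)
qed

theorem wreath_product_embeds: "embeds_in (wreath_product A G) (topological_full_group S)"
  by (rule embeds_in_topological_full_groupI[where \<Psi> = wact])
    (use wact_shift wact_mult wact_inj in blast)+

end

section \<open>Group actions along finite patterns\<close>

lemma shift_map_shift_pow: "shift_map (shift_pow n)"
  unfolding shift_map_def is_local_def by (intro exI[of _ "\<lambda>_. n"] exI[of _ "\<bar>n\<bar>"]) simp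

text \<open>A pattern \<open>t\<close> may occur at a position \<open>p\<close> of the tape (\<open>Q t x p\<close>); the element \<open>k\<close>
  of the group labels the cell \<open>p + pos t k\<close>, and the head sits at position \<open>0\<close>.\<close>

locale pattern_action = K: group K for K :: "('k, 'm) monoid_scheme" (structure) +
  fixes T :: "'t set" and Q :: "'t \<Rightarrow> (int \<Rightarrow> 'b) \<Rightarrow> int \<Rightarrow> bool" and pos :: "'t \<Rightarrow> 'k \<Rightarrow> int"
  assumes fin: "finite (carrier K)" "finite T"
    and Q_shift: "Q t (shift_pow n x) p = Q t x (p + n)"
    and Q_local: "t \<in> T \<Longrightarrow> is_local (\<lambda>x. Q t x p)"
    and uniq: "\<lbrakk>t \<in> T; k \<in> carrier K; Q t x (- pos t k); t' \<in> T; k' \<in> carrier K; Q t' x (- pos t' k')\<rbrakk>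
      \<Longrightarrow> (t, k) = (t', k')"
begin

text \<open>Kept as a set, which \<open>uniq\<close> makes empty or a singleton: a finite family of
  local conditions yields a local function at once.\<close>

definition state :: "(int \<Rightarrow> 'b) \<Rightarrow> ('t \<times> 'k) set" where
  "state x = {s \<in> T \<times> carrier K. Q (fst s) x (- pos (fst s) (snd s))}"

text \<open>The left regular action on labels within one occurrence of a pattern, and the identity
  when the head is on no labelled cell.\<close>

definition act :: "'k \<Rightarrow> (int \<Rightarrow> 'b) \<Rightarrow> int \<Rightarrow> 'b" where
  "act g x = shift_pow
     (if state x = {} then 0
      else let (t, k) = the_elem (state x) in pos t (g \<otimes> k) - pos t k) x"

lemma state_iff: "(t, k) \<in> state x \<longleftrightarrow> t \<in> T \<and> k \<in> carrier K \<and> Q t x (- pos t k)"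
  by (auto simp: state_def)

lemma state_unique: "s \<in> state x \<Longrightarrow> state x = {s}"
  using uniq by (cases s) (force simp: state_def)

lemma act_empty: "state x = {} \<Longrightarrow> act g x = x"
  by (simp add: act_def)

lemma act_state: "(t, k) \<in> state x \<Longrightarrow> act g x = shift_pow (pos t (g \<otimes> k) - pos t k) x"
  using state_unique[of "(t, k)" x] by (auto simp: act_def)

text \<open>The terms \<open>pos t (g \<otimes> k)\<close> cancel: the occurrence keeps its place on
  the tape and only the head has moved.\<close>

lemma state_act:
  assumes "(t, k) \<in> state x" "g \<in> carrier K"
  shows "(t, g \<otimes> k) \<in> state (act g x)"
  using assms by (auto simp: act_state state_iff Q_shift)

lemma act_mult:
  assumes "g \<in> carrier K" "h \<in> carrier K"
  shows "act (g \<otimes> h) x = act g (act h x)"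
proof (cases "state x = {}")
  case True
  then show ?thesis by (simp add: act_empty)
next
  case False
  then obtain t k where s: "(t, k) \<in> state x" by auto
  then have "k \<in> carrier K" by (simp add: state_iff)
  then show ?thesis
    using act_state[OF state_act[OF s assms(2)], of g] act_state[OF s] assms by (simp add: K.m_assoc)
qed

lemma act_one: "act \<one> x = x"
proof (cases "state x = {}")
  case False
  then obtain t k where s: "(t, k) \<in> state x" by auto
  then have "k \<in> carrier K" by (simp add: state_iff)
  then show ?thesis using act_state[OF s] by simp
qed (simp add: act_empty)

lemma act_free:
  assumes "(t, k) \<in> state x" "g \<in> carrier K" "act g x = x"
  shows "g = \<one>"
proof -
  have "(t, g \<otimes> k) \<in> state x" using state_act[OF assms(1,2)] assms(3) by simp
  with state_unique[OF assms(1)] have "g \<otimes> k = k" by auto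
  then show ?thesis using assms(1,2) by (auto simp: state_iff)
qed

lemma shift_map_act: "shift_map (act g)"
proof -
  have "is_local state"
    unfolding state_def
  proof (rule is_local_Collect)
    show "is_local (\<lambda>x. Q (fst t) x (- pos (fst t) (snd t)))" if "t \<in> T \<times> carrier K" for t
      using that by (intro Q_local) auto
  qed (simp add: fin)
  then have "shift_map (\<lambda>x. (\<lambda>s. shift_pow (if s = {} then 0
      else let (t, k) = the_elem s in pos t (g \<otimes> k) - pos t k)) (state x) x)"
  proof (rule shift_map_choice[where V = "Pow (T \<times> carrier K)"])
    show "state x \<in> Pow (T \<times> carrier K)" for x by (auto simp: state_def)
  qed (simp_all add: fin shift_map_shift_pow)
  then show ?thesis
    unfolding act_def .
qed

end

section \<open>Cells and blocks\<close>

text \<open>A cell of the tape is a word \<open>0\<^sup>N 1 y\<close>, where \<open>1\<close> stands for the symbol \<open>s\<close> and \<open>0\<close> for any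
  other symbol.  The head being on one of the first \<open>N\<close> positions of a cell stores an
  element of \<open>A\<close>; the bit \<open>y\<close> says whether the cell is marked.  A block is a run of blank cells between
  two marked ones, and its length encodes a pair \<open>(j, h)\<close> with \<open>h\<close> in the group \<open>K j\<close>, which acts
  on the cells of the block through the labelling \<open>\<iota> j h\<close> in such a way that \<open>h\<close> sends
  the left end to the right end.\<close>

locale tape = A: comm_group A for A :: "('a, 'm) monoid_scheme" (structure) +
  fixes s :: 'b and N :: int and e :: "'a \<Rightarrow> int"
    and J :: "'j set" and K :: "'j \<Rightarrow> 'k monoid"
    and len :: "'j \<Rightarrow> 'k \<Rightarrow> int" and \<iota> :: "'j \<Rightarrow> 'k \<Rightarrow> 'k \<Rightarrow> int"
  assumes finA: "finite (carrier A)" and e: "bij_betw e (carrier A) {0..<N}"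
    and K: "j \<in> J \<Longrightarrow> group (K j)" "j \<in> J \<Longrightarrow> finite (carrier (K j))"
    and len_pos: "j \<in> J \<Longrightarrow> h \<in> carrier (K j) - {\<one>\<^bsub>K j\<^esub>} \<Longrightarrow> len j h \<ge> 1"
    and len_inj: "\<lbrakk>j \<in> J; h \<in> carrier (K j) - {\<one>\<^bsub>K j\<^esub>}; j' \<in> J; h' \<in> carrier (K j') - {\<one>\<^bsub>K j'\<^esub>};
      len j h = len j' h'\<rbrakk> \<Longrightarrow> (j, h) = (j', h')"
    and iota: "\<lbrakk>j \<in> J; h \<in> carrier (K j) - {\<one>\<^bsub>K j\<^esub>}\<rbrakk> \<Longrightarrow>
      inj_on (\<iota> j h) (carrier (K j)) \<and> \<iota> j h ` carrier (K j) \<subseteq> {0..len j h + 1}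
      \<and> \<iota> j h \<one>\<^bsub>K j\<^esub> = 0 \<and> \<iota> j h h = len j h + 1"
begin

abbreviation L :: int where "L \<equiv> N + 2"

definition cell :: "(int \<Rightarrow> 'b) \<Rightarrow> int \<Rightarrow> bool" where
  "cell x p \<longleftrightarrow> (\<forall>t\<in>{p..<p + N}. x t \<noteq> s) \<and> x (p + N) = s"

definition marked :: "(int \<Rightarrow> 'b) \<Rightarrow> int \<Rightarrow> bool" where
  "marked x p \<longleftrightarrow> cell x p \<and> x (p + N + 1) = s"

definition block :: "(int \<Rightarrow> 'b) \<Rightarrow> int \<Rightarrow> int \<Rightarrow> bool" where
  "block x p l \<longleftrightarrow> marked x p \<and> marked x (p + L * (l + 1))
     \<and> (\<forall>c\<in>{1..l}. cell x (p + L * c) \<and> \<not> marked x (p + L * c))"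

abbreviation letters :: "'j \<Rightarrow> 'k set" where
  "letters j \<equiv> carrier (K j) - {\<one>\<^bsub>K j\<^esub>}"

text \<open>The second condition keeps two adjacent blocks of the same type from both claiming
  their common end.\<close>

definition active :: "'j \<Rightarrow> 'k \<Rightarrow> (int \<Rightarrow> 'b) \<Rightarrow> int \<Rightarrow> bool" where
  "active j h x p \<longleftrightarrow> block x p (len j h)
     \<and> (\<forall>h'\<in>letters j. \<not> block x (p + L * (len j h + 1)) (len j h'))"

lemma N_pos: "N \<ge> 1"
  using bij_betwE[OF e] A.one_closed by force

lemma cell_shift: "cell (shift_pow n x) p = cell x (p + n)"
proof -
  have "(\<forall>t\<in>{p..<p + N}. x (t + n) \<noteq> s) \<longleftrightarrow> (\<forall>t\<in>{p + n..<p + n + N}. x t \<noteq> s)" (is "?l = ?r")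
  proof
    assume ?l
    show ?r
    proof
      fix t assume "t \<in> {p + n..<p + n + N}"
      then show "x t \<noteq> s" using bspec[OF \<open>?l\<close>, of "t - n"] by auto
    qed
  qed auto
  then show ?thesis by (simp add: cell_def shift_pow_def algebra_simps)
qed

lemma marked_shift: "marked (shift_pow n x) p = marked x (p + n)"
  by (simp add: marked_def cell_shift) (simp add: shift_pow_def algebra_simps)

lemma block_shift: "block (shift_pow n x) p l = block x (p + n) l"
  by (simp add: block_def cell_shift marked_shift algebra_simps)

lemma active_shift: "active j h (shift_pow n x) p = active j h x (p + n)"
  by (simp add: active_def block_shift algebra_simps)

lemma is_local_symbol: "is_local (\<lambda>x. x t = s)"
  by (rule is_local_comp[where F = "\<lambda>u. u = s"]) simp

lemma is_local_cell: "is_local (\<lambda>x. cell x p)"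
  unfolding cell_def by (intro is_local_conj is_local_Ball is_local_not is_local_symbol) simp

lemma is_local_marked: "is_local (\<lambda>x. marked x p)"
  unfolding marked_def by (intro is_local_conj is_local_cell is_local_symbol)

lemma is_local_block: "is_local (\<lambda>x. block x p l)"
  unfolding block_def
  by (intro is_local_conj is_local_Ball is_local_not is_local_cell is_local_marked) simp

lemma is_local_active: "j \<in> J \<Longrightarrow> is_local (\<lambda>x. active j h x p)"
  unfolding active_def by (intro is_local_conj is_local_Ball is_local_not is_local_block) (simp add: K)

text \<open>If \<open>a < b\<close>, the separator of the cell at \<open>- b\<close> sits at
  \<open>N - b\<close>, among the first \<open>N\<close> positions of the cell at
  \<open>- a\<close>, where \<open>s\<close> is forbidden.\<close>

lemma cell_offset_unique:
  assumes "cell x (- a)" "cell x (- b)" "0 \<le> a" "a < N" "0 \<le> b" "b < N"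
  shows "a = b"
proof -
  have aux: "\<not> a < b" if "cell x (- a)" "cell x (- b)" "0 \<le> a" "a < N" "0 \<le> b" "b < N" for a b
  proof
    assume "a < b"
    then have "x (- b + N) \<noteq> s" using that by (auto simp: cell_def)
    then show False using that(2) by (simp add: cell_def)
  qed
  show ?thesis using aux[of a b] aux[of b a] assms by simp
qed

lemma block_cell:
  assumes "block x p l" "0 \<le> c" "c \<le> l + 1"
  shows "cell x (p + L * c)"
proof -
  consider "c = 0" | "c = l + 1" | "c \<in> {1..l}" using assms(2,3) by force
  then show ?thesis using assms(1) by cases (auto simp: block_def marked_def)
qed

text \<open>The right end of the shorter block would be a blank cell of the longer one.\<close>

lemma block_length_unique:
  assumes "block x p l" "block x p m" "l \<ge> 0" "m \<ge> 0"
  shows "l = m"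
proof -
  have aux: "\<not> l < m" if "block x p l" "block x p m" "l \<ge> 0" for l m
  proof
    assume "l < m"
    then have "l + 1 \<in> {1..m}" using that(3) by simp
    then show False using that by (auto simp: block_def)
  qed
  show ?thesis using aux[of l m] aux[of m l] assms by simp
qed

lemma block_overlap:
  assumes "block x p l" "marked x (p + L * d)" "0 < d" "d \<le> l + 1"
  shows "d = l + 1"
  using assms by (force simp: block_def)

sublocale lamps: pattern_action A "{()}" "\<lambda>_. cell" "\<lambda>_. e"
proof
  fix x k k' and t t' :: unit
  assume *: "k \<in> carrier A" "cell x (- e k)" "k' \<in> carrier A" "cell x (- e k')"
  then have "e k \<in> {0..<N}" "e k' \<in> {0..<N}" using bij_betwE[OF e] by auto
  then have "e k = e k'" using cell_offset_unique[of x "e k" "e k'"] * by auto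
  then have "k = k'" using inj_onD[OF bij_betw_imp_inj_on[OF e]] * by blast
  then show "(t, k) = (t', k')" by simp
qed (simp_all add: finA cell_shift is_local_cell)

text \<open>The offset \<open>a\<close> of the head inside its cell belongs to the pattern and not
  to the label, so moves preserve it and with it the stored element of \<open>A\<close>.\<close>

abbreviation pos :: "'j \<Rightarrow> 'k \<times> int \<Rightarrow> 'k \<Rightarrow> int" where
  "pos j \<equiv> \<lambda>(h, a) k. L * \<iota> j h k + a"

abbreviation pattern :: "'j \<Rightarrow> 'k \<times> int \<Rightarrow> (int \<Rightarrow> 'b) \<Rightarrow> int \<Rightarrow> bool" where
  "pattern j \<equiv> \<lambda>(h, a). active j h"

lemma iota_range:
  assumes "j \<in> J" "h \<in> letters j" "k \<in> carrier (K j)"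
  shows "0 \<le> \<iota> j h k \<and> \<iota> j h k \<le> len j h + 1"
proof -
  have "\<iota> j h k \<in> {0..len j h + 1}" using iota[OF assms(1,2)] assms(3) by blast
  then show ?thesis by simp
qed

text \<open>Both offsets agree since the head is in one cell only. If the left ends differ, the
  later one is a mark inside the earlier block, hence its right end, and there \<open>active\<close>
  excludes a second block of the same factor. With a common left end, \<open>len_inj\<close> gives
  the letter and injectivity of \<open>\<iota>\<close> the label.\<close>

lemma active_unique:
  assumes j: "j \<in> J"
    and h: "h \<in> letters j" "k \<in> carrier (K j)" "active j h x (- (L * \<iota> j h k + a))"
    and h': "h' \<in> letters j" "k' \<in> carrier (K j)" "active j h' x (- (L * \<iota> j h' k' + a'))"
    and a: "a \<in> {0..<N}" "a' \<in> {0..<N}"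
  shows "((h, a), k) = ((h', a'), k')"
proof -
  note r = iota_range[OF j h(1,2)] iota_range[OF j h'(1,2)]
  have "block x (- (L * \<iota> j h k + a)) (len j h)" "block x (- (L * \<iota> j h' k' + a')) (len j h')"
    using h(3) h'(3) by (simp_all add: active_def)
  from this[THEN block_cell] r have "cell x (- a)" "cell x (- a')"
    by force+
  then have "a = a'" using cell_offset_unique a by auto
  have aux: "\<not> \<iota> j h' k' < \<iota> j h k"
    if h: "h \<in> letters j" "k \<in> carrier (K j)" "active j h x (- (L * \<iota> j h k + a))"
    and h': "h' \<in> letters j" "k' \<in> carrier (K j)" "active j h' x (- (L * \<iota> j h' k' + a))" for h k h' k'
  proof
    note r = iota_range[OF j h(1,2)] iota_range[OF j h'(1,2)]
    let ?p = "- (L * \<iota> j h k + a)" and ?d = "\<iota> j h k - \<iota> j h' k'"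
    assume "\<iota> j h' k' < \<iota> j h k"
    have q: "- (L * \<iota> j h' k' + a) = ?p + L * ?d" by (simp add: algebra_simps)
    have "marked x (- (L * \<iota> j h' k' + a))" using h'(3) by (simp add: active_def block_def)
    then have "marked x (?p + L * ?d)" unfolding q .
    then have "?d = len j h + 1"
      using block_overlap[of x ?p "len j h" ?d] h(3) r \<open>\<iota> j h' k' < \<iota> j h k\<close> by (auto simp: active_def)
    then have "\<not> block x (- (L * \<iota> j h' k' + a)) (len j h')"
      using h(3) h'(1) unfolding q by (auto simp: active_def)
    then show False using h'(3) by (simp add: active_def)
  qed
  have eq: "\<iota> j h k = \<iota> j h' k'"
    using aux[OF h h'[folded \<open>a = a'\<close>]] aux[OF h'[folded \<open>a = a'\<close>] h] by simp
  then have "len j h = len j h'"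
    using block_length_unique h(3) h'(3) len_pos[OF j h(1)] len_pos[OF j h'(1)] \<open>a = a'\<close>
    by (auto simp: active_def)
  then have "h = h'" using len_inj j h(1) h'(1) by blast
  then show ?thesis using eq \<open>a = a'\<close> iota[OF j h(1)] h(2) h'(2) by (auto simp: inj_on_def)
qed

text \<open>Each factor acts through its own finite set of patterns. Blocks of different factors may
  share an end, which is what allows a chain to be traversed.\<close>

lemma moves:
  assumes j: "j \<in> J"
  shows "pattern_action (K j) (letters j \<times> {0..<N}) (pattern j) (pos j)"
proof (intro pattern_action.intro pattern_action_axioms.intro)
  show "group (K j)" "finite (carrier (K j))" "finite (letters j \<times> {0..<N})"
    using K j by simp_all
  show "pattern j t (shift_pow n x) p = pattern j t x (p + n)" for t n x p
    by (cases t) (simp add: active_shift)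
  show "is_local (\<lambda>x. pattern j t x p)" for t p
    by (cases t) (simp add: is_local_active j)
  fix t k x t' k'
  assume *: "t \<in> letters j \<times> {0..<N}" "k \<in> carrier (K j)" "pattern j t x (- pos j t k)"
    "t' \<in> letters j \<times> {0..<N}" "k' \<in> carrier (K j)" "pattern j t' x (- pos j t' k')"
  obtain h a h' a' where t: "t = (h, a)" "t' = (h', a')" by (cases t; cases t')
  show "(t, k) = (t', k')"
    unfolding t by (rule active_unique[OF j, of h k x a h' k' a']) (use * in \<open>simp_all add: t\<close>)
qed

section \<open>Moves, lamps and their commutation\<close>

definition move :: "'j \<Rightarrow> 'k \<Rightarrow> (int \<Rightarrow> 'b) \<Rightarrow> int \<Rightarrow> 'b" where
  "move j = pattern_action.act (K j) (letters j \<times> {0..<N}) (pattern j) (pos j)"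

definition located :: "'j \<Rightarrow> (int \<Rightarrow> 'b) \<Rightarrow> 'k \<Rightarrow> int \<Rightarrow> 'k \<Rightarrow> bool" where
  "located j x h a k \<longleftrightarrow> h \<in> letters j \<and> a \<in> {0..<N} \<and> k \<in> carrier (K j)
     \<and> active j h x (- (L * \<iota> j h k + a))"

lemma located_state:
  assumes "j \<in> J"
  shows "located j x h a k \<longleftrightarrow>
    ((h, a), k) \<in> pattern_action.state (K j) (letters j \<times> {0..<N}) (pattern j) (pos j) x"
  unfolding pattern_action.state_iff[OF moves[OF assms]] located_def by simp

lemma move_located:
  "j \<in> J \<Longrightarrow> located j x h a k \<Longrightarrow>
    move j g x = shift_pow (L * (\<iota> j h (g \<otimes>\<^bsub>K j\<^esub> k) - \<iota> j h k)) x"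
  using pattern_action.act_state[OF moves, of j "(h, a)" k x g]
  by (simp add: located_state move_def algebra_simps)

lemma move_unlocated:
  assumes "j \<in> J" "\<not> (\<exists>h a k. located j x h a k)"
  shows "move j g x = x"
  unfolding move_def
proof (rule pattern_action.act_empty[OF moves[OF assms(1)]], rule equals0I)
  fix z assume "z \<in> pattern_action.state (K j) (letters j \<times> {0..<N}) (pattern j) (pos j) x"
  moreover obtain h a k where "z = ((h, a), k)" by (cases z) auto
  ultimately show False using assms located_state by blast
qed

lemma move_mult:
  "j \<in> J \<Longrightarrow> g \<in> carrier (K j) \<Longrightarrow> h \<in> carrier (K j) \<Longrightarrow>
    move j (g \<otimes>\<^bsub>K j\<^esub> h) x = move j g (move j h x)"
  unfolding move_def by (rule pattern_action.act_mult[OF moves])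

lemma move_one: "j \<in> J \<Longrightarrow> move j \<one>\<^bsub>K j\<^esub> x = x"
  unfolding move_def by (rule pattern_action.act_one[OF moves])

lemma shift_map_move: "j \<in> J \<Longrightarrow> shift_map (move j g)"
  unfolding move_def by (rule pattern_action.shift_map_act[OF moves])

abbreviation lamp :: "'a \<Rightarrow> (int \<Rightarrow> 'b) \<Rightarrow> int \<Rightarrow> 'b" where "lamp \<equiv> lamps.act"

text \<open>The displacement \<open>c' - c\<close> depends on the offset alone and not on
  \<open>y\<close>, so the same shift describes the lamp before and after a move.\<close>

lemma lamp_cell:
  assumes "cell x (- c)" "c \<in> {0..<N}" "a \<in> carrier A"
  obtains c' where "c' \<in> {0..<N}"
    "\<And>y. cell y (- c) \<Longrightarrow> lamp a y = shift_pow (c' - c) y"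
proof -
  obtain b where b: "b \<in> carrier A" "e b = c"
    using e assms(2) by (metis bij_betw_iff_bijections)
  show ?thesis
  proof (rule that)
    show "e (a \<otimes> b) \<in> {0..<N}" using bij_betwE[OF e] b assms(3) by auto
    show "lamp a y = shift_pow (e (a \<otimes> b) - c) y" if "cell y (- c)" for y
      using lamps.act_state[of "()" b y a] b that by (simp add: lamps.state_iff)
  qed
qed

lemma located_cell:
  assumes "j \<in> J" "located j x h c k" "m \<in> carrier (K j)"
  shows "cell x (L * (\<iota> j h m - \<iota> j h k) - c)"
proof -
  have "cell x (- (L * \<iota> j h k + c) + L * \<iota> j h m)"
    using assms iota_range[of j h m] by (intro block_cell[of _ _ "len j h"]) (auto simp: located_def active_def)
  then show ?thesis by (simp add: algebra_simps)
qed

lemma located_lamp: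
  assumes "j \<in> J" "located j x h c k" "a \<in> carrier A"
  shows "\<exists>c'. located j (lamp a x) h c' k"
proof -
  have "cell x (- c)" "c \<in> {0..<N}"
    using located_cell[OF assms(1,2), of k] assms(2) by (auto simp: located_def)
  then obtain c' where "c' \<in> {0..<N}" "lamp a x = shift_pow (c' - c) x"
    using lamp_cell[OF _ _ assms(3)] by metis
  then show ?thesis using assms(2) by (intro exI[of _ c']) (auto simp: located_def active_shift)
qed

text \<open>Inside a block a move is a shift by a multiple of \<open>L\<close> that keeps the
  offset, and the lamp is a shift that depends only on the offset and keeps block and label. Two
  such shifts commute.\<close>

lemma move_lamp:
  assumes j: "j \<in> J" and g: "g \<in> carrier (K j)" and a: "a \<in> carrier A"
  shows "move j g (lamp a x) = lamp a (move j g x)"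
proof (cases "\<exists>h c k. located j x h c k")
  case True
  then obtain h c k where l: "located j x h c k" by blast
  interpret Kj: group "K j" using K j by simp
  have gk: "g \<otimes>\<^bsub>K j\<^esub> k \<in> carrier (K j)" "k \<in> carrier (K j)" using g l by (auto simp: located_def)
  have c: "cell x (- c)" "c \<in> {0..<N}"
    using located_cell[OF j l gk(2)] l by (auto simp: located_def)
  obtain c' where c': "c' \<in> {0..<N}" "\<And>y. cell y (- c) \<Longrightarrow> lamp a y = shift_pow (c' - c) y"
    using lamp_cell[OF c a] by metis
  have l': "located j (lamp a x) h c' k"
    using l c'(1) c'(2)[OF c(1)] by (auto simp: located_def active_shift)
  have "cell (move j g x) (- c)"
    using located_cell[OF j l gk(1)] by (simp add: move_located[OF j l] cell_shift algebra_simps)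
  then have "lamp a (move j g x) = shift_pow (c' - c) (move j g x)" by (rule c'(2))
  also have "\<dots> = shift_pow (L * (\<iota> j h (g \<otimes>\<^bsub>K j\<^esub> k) - \<iota> j h k)) (shift_pow (c' - c) x)"
    by (simp add: move_located[OF j l] add.commute)
  also have "\<dots> = move j g (lamp a x)"
    by (simp only: move_located[OF j l'] flip: c'(2)[OF c(1)])
  finally show ?thesis ..
next
  case False
  \<comment> \<open>A lamp cannot bring the head into a block, since the inverse lamp would then
    show that it was there before.\<close>
  have "\<not> (\<exists>h c k. located j (lamp a x) h c k)"
  proof
    assume "\<exists>h c k. located j (lamp a x) h c k"
    then have "\<exists>h c k. located j (lamp (inv a) (lamp a x)) h c k"
      using located_lamp[OF j _ A.inv_closed[OF a]] by blast
    then show False using False a lamps.act_mult[of "inv a" a x] by (simp add: lamps.act_one)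
  qed
  then show ?thesis using False move_unlocated[OF j] by simp
qed

text \<open>The head is in a marked cell followed by another one. Allowing every offset
  \<open>c\<close> makes the condition invariant under lamps.\<close>

definition target :: "(int \<Rightarrow> 'b) set" where
  "target = {x. \<exists>c\<in>{0..<N}. marked x (- c) \<and> marked x (L - c)}"

lemma is_local_target: "is_local (\<lambda>x. x \<in> target)"
  unfolding target_def mem_Collect_eq
  by (intro is_local_Bex is_local_conj is_local_marked) simp

lemma target_lamp:
  assumes "a \<in> carrier A" "x \<in> target"
  shows "lamp a x \<in> target"
proof -
  obtain c where c: "c \<in> {0..<N}" "marked x (- c)" "marked x (L - c)"
    using assms(2) by (auto simp: target_def)
  then have "cell x (- c)" by (simp add: marked_def)
  then obtain c' where "c' \<in> {0..<N}" "lamp a x = shift_pow (c' - c) x"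
    using lamp_cell[OF _ c(1) assms(1)] by metis
  moreover have "marked (shift_pow (c' - c) x) (- c')" "marked (shift_pow (c' - c) x) (L - c')"
    using c(2,3) by (simp_all add: marked_shift algebra_simps)
  ultimately show ?thesis by (auto simp: target_def)
qed

end

section \<open>Chains of blocks\<close>

lemma reduced_word_iff:
  "reduced_word I H w \<longleftrightarrow>
    set w \<subseteq> (SIGMA i:I. carrier (H i) - {\<one>\<^bsub>H i\<^esub>}) \<and> distinct_adj (map fst w)"
  by (auto simp: reduced_word_def distinct_adj_conv_nth)

lemma reduced_word_rev: "reduced_word I H w \<Longrightarrow> reduced_word I H (rev w)"
  by (simp add: reduced_word_iff rev_map[symmetric])

definition (in tape) word_act :: "('j \<times> 'k) list \<Rightarrow> (int \<Rightarrow> 'b) \<Rightarrow> int \<Rightarrow> 'b" where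
  "word_act w x = foldr (\<lambda>(j, k). move j k) w x"

text \<open>\<open>ws\<close> lists letters in the order in which they act, whereas
  \<open>word_act\<close> applies the last letter of a word first; a word is therefore spelled out
  reversed.\<close>

locale chain = tape A s N e J K len \<iota>
  for A :: "('a, 'm) monoid_scheme" (structure)
    and s :: 'b and N :: int and e :: "'a \<Rightarrow> int"
    and J :: "'j set" and K :: "'j \<Rightarrow> 'k monoid"
    and len :: "'j \<Rightarrow> 'k \<Rightarrow> int" and \<iota> :: "'j \<Rightarrow> 'k \<Rightarrow> 'k \<Rightarrow> int" +
  fixes z :: 'b and ws :: "('j \<times> 'k) list"
  assumes zs: "z \<noteq> s" and ws: "reduced_word J K ws"
begin

text \<open>Past the last letter the gaps vanish, so that the end of the chain is the first place with
  two consecutive marks.\<close>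

definition gap :: "nat \<Rightarrow> int" where
  "gap q = (if q < length ws then len (fst (ws ! q)) (snd (ws ! q)) else 0)"

text \<open>Cell number of the \<open>r\<close>-th mark, starting from 0. Beyond the chain it grows
  by 1, so every later cell is marked.\<close>

definition E :: "nat \<Rightarrow> int" where
  "E r = (\<Sum>q<r. gap q + 1)"

definition conf :: "int \<Rightarrow> 'b" where
  "conf p = (if p mod L = N \<or> p mod L = N + 1 \<and> p div L \<in> range E then s else z)"

text \<open>The head is at the left end of cell \<open>c\<close> of the fixed tape
  \<open>conf\<close>.\<close>

definition tp :: "int \<Rightarrow> int \<Rightarrow> 'b" where
  "tp c = shift_pow (L * c) conf"

lemma letter:
  assumes "q < length ws"
  shows "fst (ws ! q) \<in> J \<and> snd (ws ! q) \<in> letters (fst (ws ! q))"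
proof -
  have "\<forall>x\<in>set ws. fst x \<in> J \<and> snd x \<in> letters (fst x)"
    using ws by (auto simp: reduced_word_def)
  then show ?thesis using nth_mem[OF assms] by blast
qed

lemma gap_pos: "q < length ws \<Longrightarrow> gap q \<ge> 1"
  using letter[of q] len_pos by (auto simp: gap_def)

lemma gap_nonneg: "gap q \<ge> 0"
  using gap_pos[of q] by (cases "q < length ws") (auto simp: gap_def)

lemma gap_len: "ws ! q = (j, h) \<Longrightarrow> q < length ws \<Longrightarrow> gap q = len j h"
  by (simp add: gap_def)

lemma gap_eq_len:
  assumes "j \<in> J" "h \<in> letters j" "gap q = len j h"
  shows "q < length ws \<and> ws ! q = (j, h)"
proof -
  have q: "q < length ws"
    using len_pos[OF assms(1,2)] assms(3) by (auto simp: gap_def split: if_splits)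
  then have "len (fst (ws ! q)) (snd (ws ! q)) = len j h" using assms(3) by (simp add: gap_def)
  then have "(fst (ws ! q), snd (ws ! q)) = (j, h)"
    using len_inj[of "fst (ws ! q)" "snd (ws ! q)" j h] letter[OF q] assms(1,2) by blast
  then show ?thesis using q by simp
qed

text \<open>Reducedness makes neighbouring blocks belong to different factors, so the second
  condition in \<open>active\<close> never disables a block of the chain.\<close>

lemma gap_Suc_ne:
  assumes "j \<in> J" "h \<in> letters j" "gap q = len j h" "h' \<in> letters j"
  shows "gap (Suc q) \<noteq> len j h'"
proof
  assume "gap (Suc q) = len j h'"
  then have "Suc q < length ws" "fst (ws ! Suc q) = j" "fst (ws ! q) = j"
    using gap_eq_len[OF assms(1,4)] gap_eq_len[OF assms(1-3)] by auto
  then show False using ws by (auto simp: reduced_word_def)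
qed

lemma E_Suc: "E (Suc r) = E r + gap r + 1"
  by (simp add: E_def)

lemma E_mono: "strict_mono E"
  unfolding strict_mono_Suc_iff using gap_nonneg by (auto simp: E_Suc add_strict_increasing)

lemma E_less_iff [simp]: "E q < E r \<longleftrightarrow> q < r"
  using E_mono by (rule strict_mono_less)

lemma E_le_iff [simp]: "E q \<le> E r \<longleftrightarrow> q \<le> r"
  using E_mono by (rule strict_mono_less_eq)

lemma E_eq_iff [simp]: "E q = E r \<longleftrightarrow> q = r"
  using E_mono by (rule strict_mono_eq)

lemma conf_at:
  assumes "0 \<le> r" "r < L"
  shows "conf (L * c + r) = (if r = N \<or> r = N + 1 \<and> c \<in> range E then s else z)"
proof -
  have "(L * c + r) mod L = r" "(L * c + r) div L = c" using assms by auto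
  then show ?thesis by (simp only: conf_def)
qed

text \<open>With \<open>r\<close> the residue of \<open>p\<close>: for \<open>r = 1\<close> a true
  separator falls where \<open>s\<close> is forbidden, and for \<open>r \<ge> 2\<close> the supposed
  separator falls among the first \<open>N\<close> positions of the next cell. The mark bit thus
  never creates a misaligned cell.\<close>

lemma cell_conf: "cell conf p \<longleftrightarrow> (\<exists>c. p = L * c)"
proof
  assume cell: "cell conf p"
  define c r where "c = p div L" and "r = p mod L"
  have r: "0 \<le> r" "r < L" "p = L * c + r" using N_pos by (auto simp: c_def r_def)
  have *: "conf (p + N) = s" "\<And>t. p \<le> t \<Longrightarrow> t < p + N \<Longrightarrow> conf t \<noteq> s"
    using cell by (auto simp: cell_def)
  consider "r = 0" | "r = 1" | "r \<ge> 2" using r by linarith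
  then have "r = 0"
  proof cases
    case 2
    then have "p \<le> L * c + N" "L * c + N < p + N" using r N_pos by auto
    then show ?thesis using *(2) conf_at[of N c] N_pos by auto
  next
    case 3
    have "p + N = L * (c + 1) + (r - 2)" using r(3) by (simp add: algebra_simps)
    then have "conf (p + N) = z" using r 3 by (simp only: conf_at[of "r - 2" "c + 1"]) simp
    then show ?thesis using *(1) zs by simp
  qed
  then show "\<exists>c. p = L * c" using r(3) by auto
next
  assume "\<exists>c. p = L * c"
  then obtain c where p: "p = L * c" by auto
  have "conf t \<noteq> s" if "t \<in> {p..<p + N}" for t
    using conf_at[of "t - p" c] that p zs by auto
  then show "cell conf p" using conf_at[of N c] N_pos by (auto simp: cell_def p)
qed

lemma marked_conf_mult [simp]: "marked conf (L * c) \<longleftrightarrow> c \<in> range E"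
proof -
  have "cell conf (L * c)" by (auto simp: cell_conf)
  moreover have "conf (L * c + N + 1) = s \<longleftrightarrow> c \<in> range E"
    using conf_at[of "N + 1" c] N_pos zs by (simp add: add.assoc)
  ultimately show ?thesis
    by (simp add: marked_def)
qed

lemma marked_conf: "marked conf p \<longleftrightarrow> (\<exists>q. p = L * E q)"
proof
  assume m: "marked conf p"
  then obtain c where "p = L * c" by (auto simp: marked_def cell_conf)
  then show "\<exists>q. p = L * E q" using m marked_conf_mult[of c] by auto
qed auto

lemma block_conf_gap: "block conf (L * E q) (gap q)"
proof -
  have "E q + c \<notin> range E" if "c \<in> {1..gap q}" for c
  proof
    assume "E q + c \<in> range E"
    then obtain r where r: "E q + c = E r" by auto
    then have "E q < E r" "E r < E (Suc q)" using that by (auto simp: E_Suc simp del: E_less_iff)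
    then show False by simp
  qed
  moreover have "L * E q + L * c = L * (E q + c)" for c by (simp add: algebra_simps)
  moreover have "E q + (gap q + 1) = E (Suc q)" by (simp add: E_Suc)
  ultimately show ?thesis
    by (auto simp only: block_def marked_conf_mult cell_conf)
qed

lemma block_conf:
  assumes "l \<ge> 0"
  shows "block conf p l \<longleftrightarrow> (\<exists>q. p = L * E q \<and> l = gap q)"
proof
  assume b: "block conf p l"
  then obtain q where "p = L * E q" by (auto simp: block_def marked_conf)
  then show "\<exists>q. p = L * E q \<and> l = gap q"
    using block_length_unique b block_conf_gap gap_nonneg assms by blast
qed (auto simp: block_conf_gap)

lemma active_conf:
  assumes "j \<in> J" "h \<in> letters j"
  shows "active j h conf p \<longleftrightarrow> (\<exists>q. p = L * E q \<and> len j h = gap q)"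
proof -
  have l: "len j h' \<ge> 0" if "h' \<in> letters j" for h' using len_pos[OF assms(1) that] by simp
  have "\<not> block conf (L * E q + L * (gap q + 1)) (len j h')"
    if q: "len j h = gap q" and h': "h' \<in> letters j" for q h'
  proof
    assume "block conf (L * E q + L * (gap q + 1)) (len j h')"
    moreover have "L * E q + L * (gap q + 1) = L * E (Suc q)" by (simp add: E_Suc algebra_simps)
    ultimately obtain r where "L * E (Suc q) = L * E r" "len j h' = gap r"
      using block_conf[OF l[OF h']] by auto
    then have "gap (Suc q) = len j h'" using N_pos by auto
    then show False using gap_Suc_ne[OF assms q[symmetric] h'] by simp
  qed
  then show ?thesis
    using block_conf[OF l[OF assms(2)]] unfolding active_def by metis
qed

lemma marked_at: "a \<in> {0..<N} \<Longrightarrow> marked (tp c) (L * d - a) \<longleftrightarrow> a = 0 \<and> c + d \<in> range E"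
proof -
  assume a: "a \<in> {0..<N}"
  have "a = 0" if "L * d - a + L * c = L * u" for u
  proof -
    have "a = L * (d + c - u)" using that by (simp add: algebra_simps)
    then have "L dvd a" by simp
    then show ?thesis using a zdvd_not_zless[of a L] by force
  qed
  moreover have "L * d + L * c = L * (c + d)" by (simp add: algebra_simps)
  ultimately show ?thesis
    using marked_conf_mult[of "c + d"] by (auto simp: tp_def marked_shift marked_conf)
qed

lemma located_at:
  assumes "j \<in> J"
  shows "located j (tp c) h a k \<longleftrightarrow> h \<in> letters j \<and> a = 0 \<and> k \<in> carrier (K j) \<and>
    (\<exists>q. c = E q + \<iota> j h k \<and> len j h = gap q)"
proof -
  have "(- (L * \<iota> j h k + a) + L * c = L * E q) \<longleftrightarrow> a = 0 \<and> c = E q + \<iota> j h k"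
    if "a \<in> {0..<N}" for q
  proof
    assume *: "- (L * \<iota> j h k + a) + L * c = L * E q"
    then have a: "a = L * (c - \<iota> j h k - E q)" by (simp add: algebra_simps)
    then have "L dvd a" by simp
    then have "a = 0" using that zdvd_not_zless[of a L] by force
    then show "a = 0 \<and> c = E q + \<iota> j h k" using a N_pos by simp
  qed (auto simp: algebra_simps)
  then show ?thesis
    using active_conf[OF assms, of h] N_pos
    by (auto simp: located_def tp_def active_shift)
qed

lemma move_at:
  assumes "j \<in> J" "h \<in> letters j" "m \<in> carrier (K j)" "gap q = len j h"
  shows "move j k (tp (E q + \<iota> j h m)) = tp (E q + \<iota> j h (k \<otimes>\<^bsub>K j\<^esub> m))"
proof -
  have "located j (tp (E q + \<iota> j h m)) h 0 m" using located_at assms by auto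
  from move_located[OF assms(1) this] show ?thesis by (simp add: tp_def algebra_simps)
qed

lemma move_cases:
  assumes "j \<in> J" "k \<in> carrier (K j)"
  obtains (stay) "move j k (tp c) = tp c"
  | (block) h m q where "h \<in> letters j" "gap q = len j h" "move j k (tp c) = tp (E q + \<iota> j h (k \<otimes>\<^bsub>K j\<^esub> m))"
      "E q \<le> c" "c \<le> E (Suc q)" "E q + \<iota> j h (k \<otimes>\<^bsub>K j\<^esub> m) \<le> E (Suc q)"
proof (cases "\<exists>h a m. located j (tp c) h a m")
  case True
  interpret Kj: group "K j" using K assms by simp
  obtain h m q where *: "h \<in> letters j" "m \<in> carrier (K j)" "c = E q + \<iota> j h m" "gap q = len j h"
    using True located_at[OF assms(1)] by auto
  have "k \<otimes>\<^bsub>K j\<^esub> m \<in> carrier (K j)" using assms * by simp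
  then show ?thesis
    using block[of h q m] * move_at[OF assms(1) *(1,2,4)] iota_range[OF assms(1) *(1)]
      iota_range[OF assms(1) *(1,2)] by (auto simp: E_Suc)
next
  case False
  then show ?thesis using stay move_unlocated assms by simp
qed

text \<open>Every letter advances past at most one end of a block, and it advances from one end
  to the next only if it is the letter encoded by the block in between.\<close>

lemma word_act_reach:
  assumes "\<forall>(j, k)\<in>set v. j \<in> J \<and> k \<in> carrier (K j)" "length v \<le> length ws"
  shows "\<exists>c. word_act v (tp 0) = tp c \<and> c \<le> E (length v)
    \<and> (c = E (length v) \<longleftrightarrow> rev v = take (length v) ws)"
  using assms
proof (induction v)
  case Nil
  then show ?case by (intro exI[of _ 0]) (simp add: word_act_def E_def)
next
  case (Cons x u)
  obtain j k where x: "x = (j, k)" by (cases x)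
  have j: "j \<in> J" "k \<in> carrier (K j)" using Cons.prems(1) x by auto
  let ?r = "length u"
  have r: "?r < length ws" using Cons.prems by simp
  obtain c where c: "word_act u (tp 0) = tp c" "c \<le> E ?r" "c = E ?r \<longleftrightarrow> rev u = take ?r ws"
    using Cons.IH Cons.prems by auto
  have w: "word_act (x # u) (tp 0) = move j k (tp c)"
    using c(1) by (simp add: word_act_def x)
  have t: "rev (x # u) = take (Suc ?r) ws \<longleftrightarrow> c = E ?r \<and> ws ! ?r = (j, k)"
    using r c(3) by (auto simp: take_Suc_conv_app_nth x)
  have *: "\<exists>c'. move j k (tp c) = tp c' \<and> c' \<le> E (Suc ?r)
    \<and> (c' = E (Suc ?r) \<longleftrightarrow> c = E ?r \<and> ws ! ?r = (j, k))"
  proof (cases "c = E ?r \<and> fst (ws ! ?r) = j")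
    case True
    define h where "h = snd (ws ! ?r)"
    have h: "ws ! ?r = (j, h)" "h \<in> letters j" using True letter[OF r] by (auto simp: h_def)
    interpret Kj: group "K j" using K j by simp
    have io: "\<iota> j h \<one>\<^bsub>K j\<^esub> = 0" "\<iota> j h h = len j h + 1" "inj_on (\<iota> j h) (carrier (K j))"
      using iota[OF j(1) h(2)] by auto
    \<comment> \<open>At the left end the label is the identity, so \<open>k\<close> leads to the
      label \<open>k\<close>, which by injectivity is the right end only for
      \<open>k = h\<close>.\<close>
    have "move j k (tp c) = tp (E ?r + \<iota> j h k)"
      using move_at[OF j(1) h(2) Kj.one_closed gap_len[OF h(1) r], of k] io(1) True j(2) by simp
    moreover have "\<iota> j h k = len j h + 1 \<longleftrightarrow> k = h"
      using inj_on_eq_iff[OF io(3), of k h] j(2) h(2) io(2) by auto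
    ultimately show ?thesis
      using iota_range[OF j(1) h(2) j(2)] True h(1) gap_len[OF h(1) r]
      by (intro exI[of _ "E ?r + \<iota> j h k"]) (auto simp: E_Suc)
  next
    case False
    then have ne: "\<not> (c = E ?r \<and> ws ! ?r = (j, k))" by auto
    have lt: "E ?r < E (Suc ?r)" by simp
    show ?thesis
      using j
    proof (cases rule: move_cases[where c = c])
      case stay
      moreover have "c < E (Suc ?r)" using lt c(2) by linarith
      ultimately show ?thesis using ne by (intro exI[of _ c]) auto
    next
      case (block h m q)
      \<comment> \<open>Otherwise the head is at the left end of block \<open>length u\<close> and
        that block belongs to factor \<open>j\<close>, which is the case already treated. An earlier
        block cannot carry the head beyond \<open>E (length u)\<close>.\<close>
      have "q < ?r"
      proof (rule ccontr)
        assume "\<not> q < ?r"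
        then have "E ?r \<le> E q" by simp
        then have "E q = E ?r" using block(4) c(2) by linarith
        moreover from this have "c = E ?r" using block(4) c(2) by simp
        moreover have "fst (ws ! q) = j" using gap_eq_len[OF j(1) block(1,2)] by simp
        ultimately show False using False by simp
      qed
      then have "E (Suc q) \<le> E ?r" by simp
      then have "E q + \<iota> j h (k \<otimes>\<^bsub>K j\<^esub> m) < E (Suc ?r)" using block(6) lt by linarith
      then show ?thesis using block(3) ne by (intro exI[of _ "E q + \<iota> j h (k \<otimes>\<^bsub>K j\<^esub> m)"]) auto
    qed
  qed
  show ?case unfolding w length_Cons t using * .
qed

text \<open>Gaps of the chain are at least 1, so marks before its end are never adjacent; the first
  vanishing gap follows its last letter.\<close>

lemma at_target:
  assumes "c \<le> E (length ws)"
  shows "tp c \<in> target \<longleftrightarrow> c = E (length ws)"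
proof -
  have "tp c \<in> target \<longleftrightarrow> c \<in> range E \<and> c + 1 \<in> range E"
    using marked_at[of _ c 0] marked_at[of _ c 1] N_pos by (auto simp: target_def)
  also have "\<dots> \<longleftrightarrow> c = E (length ws)"
  proof
    assume "c \<in> range E \<and> c + 1 \<in> range E"
    then obtain q q' where q: "c = E q" "c + 1 = E q'" by auto
    then have "E q < E q'" by (simp del: E_less_iff)
    then have "E (Suc q) \<le> E q'" by simp
    then have "\<not> q < length ws" using q gap_pos[of q] by (auto simp: E_Suc)
    moreover have "q \<le> length ws" using q(1) assms by simp
    ultimately show "c = E (length ws)" using q(1) by simp
  next
    assume "c = E (length ws)"
    moreover have "E (length ws) + 1 = E (Suc (length ws))" by (simp add: E_Suc gap_def)
    ultimately show "c \<in> range E \<and> c + 1 \<in> range E" by auto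
  qed
  finally show ?thesis .
qed

end

context tape
begin

lemma separating_point:
  assumes W: "finite W" "W \<noteq> {}" "\<forall>w\<in>W. reduced_word J K w" and "z \<noteq> s"
  shows "\<exists>x. (\<forall>i. x i \<in> {s, z}) \<and>
    (\<exists>w\<in>W. word_act w x \<in> target \<and> (\<forall>v\<in>W. word_act v x \<in> target \<longrightarrow> v = w)) \<and>
    (\<forall>a\<in>carrier A. lamp a x = x \<longrightarrow> a = \<one>)"
proof -
  have "Max (length ` W) \<in> length ` W" using W by (intro Max_in) auto
  then obtain w where w: "w \<in> W" "Max (length ` W) = length w" by auto
  then have le: "length v \<le> length w" if "v \<in> W" for v
    using Max_ge[of "length ` W" "length v"] W(1) that by simp
  interpret chain A s N e J K len \<iota> z "rev w"
    by unfold_locales (use reduced_word_rev bspec[OF W(3) w(1)] assms(4) in auto)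
  have reach: "\<exists>c. word_act v (tp 0) = tp c \<and> c \<le> E (length v)
    \<and> (c = E (length v) \<longleftrightarrow> rev v = take (length v) (rev w))" if "v \<in> W" for v
    using bspec[OF W(3) that] le[OF that]
    by (intro word_act_reach) (auto simp: reduced_word_def)
  have "word_act w (tp 0) \<in> target"
    using reach[OF w(1)] at_target[of "E (length w)"] by auto
  moreover have "v = w" if v: "v \<in> W" and t: "word_act v (tp 0) \<in> target" for v
  proof -
    obtain c where c: "word_act v (tp 0) = tp c" "c \<le> E (length v)"
      "c = E (length v) \<longleftrightarrow> rev v = take (length v) (rev w)"
      using reach[OF v] by auto
    have "E (length v) \<le> E (length w)" using le[OF v] by simp
    with c(2) have "c \<le> E (length w)" by (rule order_trans)
    then have cw: "c = E (length w)" using at_target[of c] c(1) t by simp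
    then have "length v = length w" using c(2) le[OF v] by simp
    then show ?thesis using c(3) cw by simp
  qed
  moreover have "a = \<one>" if "a \<in> carrier A" "lamp a (tp 0) = tp 0" for a
  proof -
    obtain b where "b \<in> carrier A" "e b = 0"
      using e N_pos unfolding bij_betw_def by (metis atLeastLessThan_iff imageE order_refl zero_less_one less_le_trans)
    moreover have "cell (tp 0) 0" by (simp add: tp_def cell_conf)
    ultimately have "((), b) \<in> lamps.state (tp 0)" by (simp add: lamps.state_iff)
    then show ?thesis using lamps.act_free that by blast
  qed
  moreover have "tp 0 i \<in> {s, z}" for i by (simp add: tp_def conf_def)
  ultimately show ?thesis using w(1) by (intro exI[of _ "tp 0"]) blast
qed

lemma shift_map_word_act:
  assumes "fst ` set w \<subseteq> J"
  shows "shift_map (word_act w)"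
  using assms
proof (induction w)
  case Nil
  have "word_act [] = (\<lambda>x. x)" by (simp add: word_act_def fun_eq_iff)
  then show ?case by simp
next
  case (Cons x w)
  have "word_act (x # w) = (\<lambda>y. move (fst x) (snd x) (word_act w y))"
    by (simp add: word_act_def fun_eq_iff case_prod_unfold)
  moreover have "shift_map (\<lambda>y. move (fst x) (snd x) (word_act w y))"
    by (rule shift_map_comp[OF shift_map_move Cons.IH]) (use Cons.prems in auto)
  ultimately show ?case by simp
qed

lemma word_act_lamp:
  assumes "a \<in> carrier A" "\<forall>(j, k)\<in>set w. j \<in> J \<and> k \<in> carrier (K j)"
  shows "word_act w (lamp a x) = lamp a (word_act w x)"
  using assms(2)
proof (induction w)
  case Nil
  then show ?case by (simp add: word_act_def)
next
  case (Cons y w)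
  obtain j k where y: "y = (j, k)" by (cases y)
  have "word_act (y # w) u = move j k (word_act w u)" for u
    by (simp add: word_act_def y)
  then show ?case using Cons move_lamp[OF _ _ assms(1)] y by simp
qed

end

section \<open>Existence of a coding\<close>

text \<open>\<open>a\<close> and \<open>b\<close> take the two ends, and an enumeration shifted by 1
  puts the other elements in between; \<open>l \<ge> int (card C)\<close> leaves enough
  room.\<close>

lemma ex_labelling:
  assumes "finite C" "a \<in> C" "b \<in> C" "a \<noteq> b" "l \<ge> int (card C)"
  shows "\<exists>f. inj_on f C \<and> f ` C \<subseteq> {0..l + 1} \<and> f a = 0 \<and> f b = l + 1"
proof -
  obtain e where e: "bij_betw e C {0..<card C}"
    using ex_bij_betw_finite_nat assms(1) by blast
  then have ec: "e c < card C" if "c \<in> C" for c using that bij_betwE by fastforce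
  define f where "f c = (if c = a then 0 else if c = b then l + 1 else int (e c) + 1)" for c
  have r: "c = a \<and> f c = 0 \<or> c = b \<and> f c = l + 1 \<or> f c = int (e c) + 1 \<and> 1 \<le> f c \<and> f c \<le> l"
    if "c \<in> C" for c
    using ec[OF that] assms(4,5) by (auto simp: f_def)
  have "l \<ge> 0" using assms(5) by simp
  have "inj_on f C"
  proof (rule inj_onI)
    fix c d assume cd: "c \<in> C" "d \<in> C" "f c = f d"
    moreover have "e c = e d \<Longrightarrow> c = d" using e cd(1,2) by (auto simp: bij_betw_def dest: inj_onD)
    ultimately show "c = d"
      using r[OF cd(1)] r[OF cd(2)] \<open>l \<ge> 0\<close> by (elim disjE conjE) auto
  qed
  moreover have "f ` C \<subseteq> {0..l + 1}"
    using r \<open>l \<ge> 0\<close> by force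
  ultimately show ?thesis using assms(4) by (intro exI[of _ f]) (auto simp: f_def)
qed

lemma ex_tape:
  fixes K :: "'j \<Rightarrow> 'k monoid"
  assumes "comm_group A" "finite (carrier A)" "countable J"
    and K: "\<And>j. j \<in> J \<Longrightarrow> group (K j)" "\<And>j. j \<in> J \<Longrightarrow> finite (carrier (K j))"
  shows "\<exists>N e len \<iota>. tape A N e J K len \<iota>"
proof -
  interpret A: comm_group A by fact
  obtain e where e: "bij_betw e (carrier A) {0..<card (carrier A)}"
    using ex_bij_betw_finite_nat assms(2) by blast
  define Lt where "Lt = (SIGMA j:J. carrier (K j) - {\<one>\<^bsub>K j\<^esub>})"
  have Lt: "countable Lt"
    unfolding Lt_def using assms(3) K(2) by (intro countable_SIGMA) (auto intro: countable_finite)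
  \<comment> \<open>Pairing the code of the letter with the order of its group makes the length
    injective in the letter and at least that order, as \<open>ex_labelling\<close> demands.\<close>
  define len where "len j h = int (prod_encode (to_nat_on Lt (j, h), card (carrier (K j))))" for j h
  have len: "len j h \<ge> int (card (carrier (K j)))" for j h
    unfolding len_def by (intro of_nat_mono le_prod_encode_2)
  have "\<exists>f. inj_on f (carrier (K j)) \<and> f ` carrier (K j) \<subseteq> {0..len j h + 1}
      \<and> f \<one>\<^bsub>K j\<^esub> = 0 \<and> f h = len j h + 1"
    if "j \<in> J" "h \<in> carrier (K j) - {\<one>\<^bsub>K j\<^esub>}" for j h
    using that K len by (intro ex_labelling) (auto intro: monoid.one_closed group.is_monoid)
  then obtain \<iota> where \<iota>: "\<And>j h. j \<in> J \<Longrightarrow> h \<in> carrier (K j) - {\<one>\<^bsub>K j\<^esub>} \<Longrightarrow>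
    inj_on (\<iota> j h) (carrier (K j)) \<and> \<iota> j h ` carrier (K j) \<subseteq> {0..len j h + 1}
      \<and> \<iota> j h \<one>\<^bsub>K j\<^esub> = 0 \<and> \<iota> j h h = len j h + 1"
    by metis
  have "tape A (int (card (carrier A))) (int \<circ> e) J K len \<iota>"
  proof (intro tape.intro tape_axioms.intro)
    show "bij_betw (int \<circ> e) (carrier A) {0..<int (card (carrier A))}"
      using bij_betw_trans[OF e, of int "{0..<int (card (carrier A))}"]
      by (simp add: bij_betw_def image_int_atLeastLessThan)
    show "1 \<le> len j h" if "j \<in> J" "h \<in> carrier (K j) - {\<one>\<^bsub>K j\<^esub>}" for j h
    proof -
      have "card (carrier (K j)) > 0" using K(2)[OF that(1)] that(2) by (auto simp: card_gt_0_iff)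
      then show ?thesis using len[of j h] by linarith
    qed
    show "(j, h) = (j', h')" if "j \<in> J" "h \<in> carrier (K j) - {\<one>\<^bsub>K j\<^esub>}"
      "j' \<in> J" "h' \<in> carrier (K j') - {\<one>\<^bsub>K j'\<^esub>}" "len j h = len j' h'" for j h j' h'
      using that to_nat_on_inj[OF Lt, of "(j, h)" "(j', h')"] by (auto simp: len_def Lt_def)
  qed (use assms K \<iota> in auto)
  then show ?thesis by blast
qed

section \<open>Actions of free products\<close>

definition word_map :: "('i \<Rightarrow> 'g \<Rightarrow> 'x \<Rightarrow> 'x) \<Rightarrow> ('i \<times> 'g) list \<Rightarrow> 'x \<Rightarrow> 'x" where
  "word_map f w x = foldr (\<lambda>(i, h). f i h) w x"

lemma word_map_simps [simp]:
  "word_map f [] x = x" "word_map f ((i, h) # w) x = f i h (word_map f w x)"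
  "word_map f (v @ w) x = word_map f v (word_map f w x)"
  by (simp_all add: word_map_def)

lemma set_cons_red:
  assumes "\<And>i. i \<in> I \<Longrightarrow> group (H i)" "i \<in> I" "g \<in> carrier (H i)"
    and "set w \<subseteq> (SIGMA i:I. carrier (H i))"
  shows "set (cons_red H (i, g) w) \<subseteq> (SIGMA i:I. carrier (H i))"
proof -
  interpret group "H i" using assms by simp
  show ?thesis using assms(2-4) by (cases w) (auto simp: Let_def split: if_splits)
qed

lemma word_map_cons_red:
  assumes "\<And>i g h x. \<lbrakk>i \<in> I; g \<in> carrier (H i); h \<in> carrier (H i)\<rbrakk> \<Longrightarrow> f i (g \<otimes>\<^bsub>H i\<^esub> h) x = f i g (f i h x)"
    and "\<And>i x. i \<in> I \<Longrightarrow> f i \<one>\<^bsub>H i\<^esub> x = x"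
    and "i \<in> I" "g \<in> carrier (H i)" "set w \<subseteq> (SIGMA i:I. carrier (H i))"
  shows "word_map f (cons_red H (i, g) w) x = f i g (word_map f w x)"
proof (cases w)
  case Nil
  then show ?thesis using assms by simp
next
  case (Cons y v)
  obtain j h where y: "y = (j, h)" by (cases y)
  consider "g = \<one>\<^bsub>H i\<^esub>" | "g \<noteq> \<one>\<^bsub>H i\<^esub>" "i = j" | "g \<noteq> \<one>\<^bsub>H i\<^esub>" "i \<noteq> j" by blast
  then show ?thesis
  proof cases
    case 1
    then show ?thesis using Cons y assms(2,3) by simp
  next
    case 2
    then have "f i g (f i h (word_map f v x)) = f i (g \<otimes>\<^bsub>H i\<^esub> h) (word_map f v x)"
      using assms(1,3,4,5) Cons y by simp
    then show ?thesis using 2 Cons y assms(2,3) by (simp add: Let_def)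
  qed (use Cons y in simp)
qed

text \<open>The universal property of the free product: each reduction step uses the law of a single
  factor, so it leaves the resulting map unchanged.\<close>

lemma word_map_foldr_cons_red:
  assumes "\<And>i. i \<in> I \<Longrightarrow> group (H i)"
    and "\<And>i g h x. \<lbrakk>i \<in> I; g \<in> carrier (H i); h \<in> carrier (H i)\<rbrakk> \<Longrightarrow> f i (g \<otimes>\<^bsub>H i\<^esub> h) x = f i g (f i h x)"
    and "\<And>i x. i \<in> I \<Longrightarrow> f i \<one>\<^bsub>H i\<^esub> x = x"
    and "set v \<subseteq> (SIGMA i:I. carrier (H i))" "set w \<subseteq> (SIGMA i:I. carrier (H i))"
  shows "word_map f (foldr (cons_red H) v w) x = word_map f v (word_map f w x)"
proof -
  have "set (foldr (cons_red H) v w) \<subseteq> (SIGMA i:I. carrier (H i)) \<and>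
    word_map f (foldr (cons_red H) v w) x = word_map f v (word_map f w x)"
    using assms(4)
  proof (induction v)
    case Nil
    then show ?case using assms(5) by simp
  next
    case (Cons y v)
    obtain i g where y: "y = (i, g)" "i \<in> I" "g \<in> carrier (H i)" using Cons.prems by (cases y) auto
    have IH: "set (foldr (cons_red H) v w) \<subseteq> (SIGMA i:I. carrier (H i))"
      "word_map f (foldr (cons_red H) v w) x = word_map f v (word_map f w x)"
      using Cons by auto
    have "set (cons_red H (i, g) (foldr (cons_red H) v w)) \<subseteq> (SIGMA i:I. carrier (H i))"
      by (rule set_cons_red) (use assms(1) y IH in auto)
    moreover have "word_map f (cons_red H (i, g) (foldr (cons_red H) v w)) x
        = f i g (word_map f (foldr (cons_red H) v w) x)"
      by (rule word_map_cons_red[OF assms(2,3) y(2,3) IH(1)]) auto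
    ultimately show ?case using IH(2) y(1) by simp
  qed
  then show ?thesis ..
qed

section \<open>Infinite cyclic factors\<close>

text \<open>An infinite cyclic factor is replaced by two factors of order two, with the product of the two
  involutions in place of the generator, so that only finite groups have to act.\<close>

definition two_group :: "'g \<Rightarrow> 'g \<Rightarrow> 'g monoid" where
  "two_group a b = \<lparr>carrier = {a, b}, monoid.mult = (\<lambda>x y. if x = y then a else b), one = a\<rparr>"

lemma group_two_group: "a \<noteq> b \<Longrightarrow> group (two_group a b)"
  by (rule groupI) (auto simp: two_group_def)

definition cyclic_map :: "('x \<Rightarrow> 'x) \<Rightarrow> ('x \<Rightarrow> 'x) \<Rightarrow> int \<Rightarrow> 'x \<Rightarrow> 'x" where
  "cyclic_map P Q n = (if n \<ge> 0 then P ^^ nat n else Q ^^ nat (- n))"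

lemma cyclic_map_add:
  assumes PQ: "\<And>x. P (Q x) = x" "\<And>x. Q (P x) = x"
  shows "cyclic_map P Q (m + n) x = cyclic_map P Q m (cyclic_map P Q n x)"
proof -
  have succ: "cyclic_map P Q (k + 1) x = P (cyclic_map P Q k x)" for k x
  proof (cases "k \<ge> 0")
    case True
    then have "nat (k + 1) = Suc (nat k)" by simp
    then show ?thesis using True by (simp add: cyclic_map_def)
  next
    case False
    then have "nat (- k) = Suc (nat (- (k + 1)))" by simp
    then have "P (cyclic_map P Q k x) = (Q ^^ nat (- (k + 1))) x"
      using False PQ by (simp add: cyclic_map_def)
    moreover have "(Q ^^ nat (- (k + 1))) x = cyclic_map P Q (k + 1) x"
      using False by (cases "k = -1") (auto simp: cyclic_map_def)
    ultimately show ?thesis by simp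
  qed
  have pred: "cyclic_map P Q (k - 1) x = Q (cyclic_map P Q k x)" for k x
    using succ[of "k - 1" x] PQ by simp
  show ?thesis
  proof (induction m rule: int_induct[of _ 0])
    case base
    then show ?case by (simp add: cyclic_map_def)
  next
    case (step1 i)
    have "cyclic_map P Q (i + 1 + n) x = cyclic_map P Q (i + n + 1) x" by (simp add: algebra_simps)
    then show ?case using succ[of "i + n" x] succ[of i] step1 by simp
  next
    case (step2 i)
    have "cyclic_map P Q (i - 1 + n) x = cyclic_map P Q (i + n - 1) x" by (simp add: algebra_simps)
    then show ?case using pred[of "i + n" x] pred[of i] step2 by simp
  qed
qed

locale finite_or_cyclic =
  fixes I :: "'i set" and H :: "'i \<Rightarrow> 'g monoid"
  assumes grp: "i \<in> I \<Longrightarrow> group (H i)"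
    and fin_cyc: "i \<in> I \<Longrightarrow> finite (carrier (H i)) \<or> H i \<cong> integer_group"
begin

text \<open>Every index is doubled for uniformity, though a finite factor is spelled with its
  \<open>False\<close> copy only. Groups of order two are built on elements of \<open>H i\<close> in
  order to stay in the type \<open>'g\<close>.\<close>

definition K :: "'i \<times> bool \<Rightarrow> 'g monoid" where
  "K = (\<lambda>(i, b). if finite (carrier (H i)) then H i
     else two_group \<one>\<^bsub>H i\<^esub> (SOME h. h \<in> carrier (H i) \<and> h \<noteq> \<one>\<^bsub>H i\<^esub>))"

definition inv_letter :: "'i \<Rightarrow> bool \<Rightarrow> ('i \<times> bool) \<times> 'g" where
  "inv_letter i b = ((i, b), SOME h. h \<in> carrier (H i) \<and> h \<noteq> \<one>\<^bsub>H i\<^esub>)"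

definition exponent :: "'i \<Rightarrow> 'g \<Rightarrow> int" where
  "exponent i = (SOME k. k \<in> iso (H i) integer_group)"

text \<open>The reduced form of \<open>(u v)^n\<close> in the infinite dihedral group, for
  involutions \<open>u\<close> and \<open>v\<close>. Negative powers alternate the other way, as
  \<open>v u\<close> is inverse to \<open>u v\<close>; the length gives the absolute value of
  \<open>n\<close> and the first letter its sign.\<close>

definition alternating :: "'i \<Rightarrow> int \<Rightarrow> (('i \<times> bool) \<times> 'g) list" where
  "alternating i n = concat (replicate (nat \<bar>n\<bar>) [inv_letter i (n < 0), inv_letter i (n \<ge> 0)])"

definition expand :: "'i \<Rightarrow> 'g \<Rightarrow> (('i \<times> bool) \<times> 'g) list" where
  "expand i h = (if finite (carrier (H i)) then [((i, False), h)] else alternating i (exponent i h))"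

definition expand_word :: "('i \<times> 'g) list \<Rightarrow> (('i \<times> bool) \<times> 'g) list" where
  "expand_word w = concat (map (\<lambda>(i, h). expand i h) w)"

lemma expand_word_simps [simp]:
  "expand_word [] = []" "expand_word ((i, h) # w) = expand i h @ expand_word w"
  by (simp_all add: expand_word_def)

lemma nontrivial:
  assumes "infinite (carrier (H i))"
  shows "(SOME h. h \<in> carrier (H i) \<and> h \<noteq> \<one>\<^bsub>H i\<^esub>) \<in> carrier (H i)"
    "(SOME h. h \<in> carrier (H i) \<and> h \<noteq> \<one>\<^bsub>H i\<^esub>) \<noteq> \<one>\<^bsub>H i\<^esub>"
proof -
  have "carrier (H i) - {\<one>\<^bsub>H i\<^esub>} \<noteq> {}"
    using assms by (metis finite.emptyI finite.insertI finite_Diff2)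
  then have "\<exists>h. h \<in> carrier (H i) \<and> h \<noteq> \<one>\<^bsub>H i\<^esub>" by auto
  from someI_ex[OF this] show "(SOME h. h \<in> carrier (H i) \<and> h \<noteq> \<one>\<^bsub>H i\<^esub>) \<in> carrier (H i)"
    "(SOME h. h \<in> carrier (H i) \<and> h \<noteq> \<one>\<^bsub>H i\<^esub>) \<noteq> \<one>\<^bsub>H i\<^esub>" by auto
qed

lemma K:
  assumes "j \<in> I \<times> UNIV"
  shows "group (K j)" "finite (carrier (K j))"
proof -
  obtain i b where j: "j = (i, b)" "i \<in> I" using assms by auto
  have "group (K j) \<and> finite (carrier (K j))"
  proof (cases "finite (carrier (H i))")
    case True
    then show ?thesis using grp j by (simp add: K_def)
  next
    case False
    then have "group (K j)"
      using nontrivial(2)[OF False] by (simp add: K_def j(1) group_two_group)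
    moreover have "finite (carrier (K j))" using False by (simp add: K_def j(1) two_group_def)
    ultimately show ?thesis ..
  qed
  then show "group (K j)" "finite (carrier (K j))" by auto
qed

lemma inv_letter:
  assumes "infinite (carrier (H i))"
  shows "snd (inv_letter i b) \<in> carrier (K (i, b))" "snd (inv_letter i b) \<noteq> \<one>\<^bsub>K (i, b)\<^esub>"
    "snd (inv_letter i b) \<otimes>\<^bsub>K (i, b)\<^esub> snd (inv_letter i b) = \<one>\<^bsub>K (i, b)\<^esub>"
  using nontrivial(2)[OF assms] assms by (simp_all add: inv_letter_def K_def two_group_def)

lemma exponent:
  assumes "i \<in> I" "infinite (carrier (H i))"
  shows "exponent i \<in> hom (H i) integer_group" "bij_betw (exponent i) (carrier (H i)) UNIV"
    "exponent i \<one>\<^bsub>H i\<^esub> = 0"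
proof -
  have "\<exists>k. k \<in> iso (H i) integer_group" using fin_cyc[OF assms(1)] assms(2) by (auto simp: is_iso_def)
  then have "exponent i \<in> iso (H i) integer_group"
    unfolding exponent_def by (rule someI_ex)
  then show *: "exponent i \<in> hom (H i) integer_group" "bij_betw (exponent i) (carrier (H i)) UNIV"
    by (auto simp: iso_def)
  show "exponent i \<one>\<^bsub>H i\<^esub> = 0"
    using hom_one[OF *(1) grp[OF assms(1)] group_integer_group] by simp
qed

lemma fst_expand: "l \<in> set (expand i h) \<Longrightarrow> fst (fst l) = i"
  by (auto simp: expand_def alternating_def inv_letter_def split: if_splits)

lemma exponent_nonzero:
  assumes "i \<in> I" "infinite (carrier (H i))" "h \<in> carrier (H i)" "h \<noteq> \<one>\<^bsub>H i\<^esub>"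
  shows "exponent i h \<noteq> 0"
proof -
  have "\<one>\<^bsub>H i\<^esub> \<in> carrier (H i)"
    using grp[OF assms(1)] by (simp add: group.is_monoid monoid.one_closed)
  then show ?thesis
    using exponent[OF assms(1,2)] assms(3,4) by (metis bij_betw_def inj_onD)
qed

lemma alternating_neq_Nil: "n \<noteq> 0 \<Longrightarrow> alternating i n \<noteq> []"
  by (simp add: alternating_def)

lemma expand_neq_Nil:
  "i \<in> I \<Longrightarrow> h \<in> carrier (H i) - {\<one>\<^bsub>H i\<^esub>} \<Longrightarrow> expand i h \<noteq> []"
  using exponent_nonzero alternating_neq_Nil by (auto simp: expand_def)

lemma length_concat_replicate: "length (concat (replicate n [a, b])) = 2 * n"
  by (induction n) auto

lemma hd_alternating: "n \<noteq> 0 \<Longrightarrow> hd (alternating i n) = inv_letter i (n < 0)"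
  by (cases "nat \<bar>n\<bar>") (auto simp: alternating_def)

lemma alternating_inj:
  assumes "alternating i m = alternating i n"
  shows "m = n"
proof -
  have "\<bar>m\<bar> = \<bar>n\<bar>"
    using arg_cong[OF assms, of length] by (simp add: alternating_def length_concat_replicate del: length_concat)
  moreover have "m < 0 \<longleftrightarrow> n < 0" if "m \<noteq> 0" "n \<noteq> 0"
    using arg_cong[OF assms, of hd] that by (auto simp: hd_alternating inv_letter_def)
  ultimately show ?thesis by linarith
qed

lemma expand_inj:
  assumes "i \<in> I" "h \<in> carrier (H i)" "h' \<in> carrier (H i)" "expand i h = expand i h'"
  shows "h = h'"
proof (cases "finite (carrier (H i))")
  case False
  then have "exponent i h = exponent i h'" using assms(4) alternating_inj by (auto simp: expand_def)
  then show ?thesis using exponent(2)[OF assms(1) False] assms(2,3) by (auto simp: bij_betw_def inj_on_def)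
qed (use assms(4) in \<open>simp add: expand_def\<close>)

lemma distinct_adj_concat_replicate: "a \<noteq> b \<Longrightarrow> distinct_adj (concat (replicate n [a, b]))"
proof (induction n)
  case (Suc n)
  then show ?case by (cases n) auto
qed simp

lemma reduced_expand:
  assumes "i \<in> I" "h \<in> carrier (H i) - {\<one>\<^bsub>H i\<^esub>}"
  shows "reduced_word (I \<times> UNIV) K (expand i h)"
proof (cases "finite (carrier (H i))")
  case True
  then show ?thesis using assms by (auto simp: reduced_word_iff expand_def K_def)
next
  case False
  have two: "set (alternating i n) \<subseteq> {inv_letter i True, inv_letter i False}" for n
    by (cases "n < 0") (auto simp: alternating_def)
  have letter: "inv_letter i b \<in> (SIGMA j:I \<times> UNIV. carrier (K j) - {\<one>\<^bsub>K j\<^esub>})" for b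
  proof -
    have "inv_letter i b = ((i, b), snd (inv_letter i b))" by (simp add: inv_letter_def)
    moreover have "((i, b), snd (inv_letter i b)) \<in> (SIGMA j:I \<times> UNIV. carrier (K j) - {\<one>\<^bsub>K j\<^esub>})"
      using inv_letter(1,2)[OF False, of b] assms(1) by blast
    ultimately show ?thesis by simp
  qed
  have "set (alternating i n) \<subseteq> (SIGMA j:I \<times> UNIV. carrier (K j) - {\<one>\<^bsub>K j\<^esub>})" for n
    by (rule subset_trans[OF two]) (simp only: insert_subset letter empty_subsetI simp_thms)
  moreover have "distinct_adj (map fst (alternating i n))" for n
    using distinct_adj_concat_replicate[of "(i, n < 0)" "(i, n \<ge> 0)" "nat \<bar>n\<bar>"]
    by (cases "n < 0") (simp_all add: alternating_def map_concat inv_letter_def)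
  ultimately show ?thesis using False by (simp add: reduced_word_iff expand_def)
qed

lemma reduced_word_Cons:
  "reduced_word I H ((i, h) # w) \<longleftrightarrow> i \<in> I \<and> h \<in> carrier (H i) - {\<one>\<^bsub>H i\<^esub>} \<and> reduced_word I H w
    \<and> (w = [] \<or> fst (hd w) \<noteq> i)"
  by (cases w) (auto simp: reduced_word_iff)

lemma fst_hd_expand_word:
  assumes "reduced_word I H w" "w \<noteq> []"
  shows "expand_word w \<noteq> [] \<and> fst (fst (hd (expand_word w))) = fst (hd w)"
proof -
  obtain i h v where w: "w = (i, h) # v" using assms(2) by (cases w) auto
  then have "expand i h \<noteq> []" using assms(1) expand_neq_Nil by (simp add: reduced_word_Cons)
  then show ?thesis using fst_expand[of "hd (expand i h)" i h] by (simp add: w)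
qed

text \<open>Adjacent letters of \<open>w\<close> have different indices \<open>i\<close>, so nothing
  can cancel where their expansions meet.\<close>

lemma reduced_expand_word: "reduced_word I H w \<Longrightarrow> reduced_word (I \<times> UNIV) K (expand_word w)"
proof (induction w)
  case Nil
  then show ?case by (simp add: reduced_word_def)
next
  case (Cons y w)
  obtain i h where y: "y = (i, h)" by (cases y)
  have w: "reduced_word I H w" "w = [] \<or> fst (hd w) \<noteq> i" and h: "i \<in> I" "h \<in> carrier (H i) - {\<one>\<^bsub>H i\<^esub>}"
    using Cons.prems by (auto simp: y reduced_word_Cons)
  have "last (map fst (expand i h)) \<noteq> hd (map fst (expand_word w))" if "expand_word w \<noteq> []"
  proof -
    have "w \<noteq> []" using that by auto
    then have "fst (fst (hd (expand_word w))) \<noteq> i" using fst_hd_expand_word w by simp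
    moreover have "fst (fst (last (expand i h))) = i"
      using fst_expand[of "last (expand i h)" i h] expand_neq_Nil[OF h] by simp
    ultimately show ?thesis using that expand_neq_Nil[OF h] by (auto simp: last_map hd_map)
  qed
  then show ?case
    using Cons.IH[OF w(1)] reduced_expand[OF h]
    by (auto simp: y reduced_word_iff distinct_adj_append_iff)
qed

text \<open>Makes the expansion decodable: the first letter is recovered from the maximal prefix
  with constant index in \<open>I\<close>.\<close>

lemma expand_word_split:
  assumes "reduced_word I H ((i, h) # w)"
  shows "takeWhile (\<lambda>l. fst (fst l) = i) (expand_word ((i, h) # w)) = expand i h"
    "dropWhile (\<lambda>l. fst (fst l) = i) (expand_word ((i, h) # w)) = expand_word w"
proof -
  let ?P = "\<lambda>l :: ('i \<times> bool) \<times> 'g. fst (fst l) = i"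
  have "expand_word w = [] \<or> \<not> ?P (hd (expand_word w))"
    using assms fst_hd_expand_word[of w] by (cases "w = []") (auto simp: reduced_word_Cons)
  then have "takeWhile ?P (expand_word w) = []" "dropWhile ?P (expand_word w) = expand_word w"
    by (simp_all only: takeWhile_eq_Nil_iff dropWhile_eq_self_iff)
  then show "takeWhile ?P (expand_word ((i, h) # w)) = expand i h"
    "dropWhile ?P (expand_word ((i, h) # w)) = expand_word w"
    using fst_expand by simp_all
qed

lemma expand_word_inj:
  assumes "reduced_word I H v" "reduced_word I H w" "expand_word v = expand_word w"
  shows "v = w"
  using assms
proof (induction v arbitrary: w)
  case Nil
  then show ?case using fst_hd_expand_word[of w] by auto
next
  case (Cons y v)
  obtain i h where y: "y = (i, h)" by (cases y)
  have ne: "w \<noteq> []" using Cons.prems fst_hd_expand_word[of "y # v"] by auto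
  then have "fst (hd w) = i"
    using Cons.prems fst_hd_expand_word[of "y # v"] fst_hd_expand_word[of w] y by simp
  then obtain h' u where w: "w = (i, h') # u" using ne by (cases w) auto
  have "expand i h = expand i h'" "expand_word v = expand_word u"
    using expand_word_split[of i h v] expand_word_split[of i h' u] Cons.prems
    unfolding y w by metis+
  moreover have "i \<in> I" "h \<in> carrier (H i)" "h' \<in> carrier (H i)" "reduced_word I H v" "reduced_word I H u"
    using Cons.prems by (auto simp: y w reduced_word_Cons)
  ultimately have "h = h'" "v = u"
    by (iprover intro: expand_inj Cons.IH)+
  then show ?case by (simp add: y w)
qed

context
  fixes M :: "'i \<times> bool \<Rightarrow> 'g \<Rightarrow> 'x \<Rightarrow> 'x"
  assumes M_mult: "\<And>j g h x. \<lbrakk>j \<in> I \<times> UNIV; g \<in> carrier (K j); h \<in> carrier (K j)\<rbrakk> \<Longrightarrow>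
      M j (g \<otimes>\<^bsub>K j\<^esub> h) x = M j g (M j h x)"
    and M_one: "\<And>j x. j \<in> I \<times> UNIV \<Longrightarrow> M j \<one>\<^bsub>K j\<^esub> x = x"
begin

lemma word_map_alternating:
  "word_map M (alternating i n) =
    cyclic_map (word_map M [inv_letter i False, inv_letter i True])
      (word_map M [inv_letter i True, inv_letter i False]) n"
proof -
  have "word_map M (concat (replicate k u)) = word_map M u ^^ k" for k u
    by (induction k) (auto simp: fun_eq_iff)
  then show ?thesis by (auto simp: alternating_def cyclic_map_def)
qed

lemma word_map_expand_mult:
  assumes "i \<in> I" "g \<in> carrier (H i)" "h \<in> carrier (H i)"
  shows "word_map M (expand i (g \<otimes>\<^bsub>H i\<^esub> h)) x = word_map M (expand i g) (word_map M (expand i h) x)"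
proof (cases "finite (carrier (H i))")
  case True
  then show ?thesis using assms M_mult[of "(i, False)" g h] by (simp add: expand_def K_def)
next
  case False
  have "M (i, b) (snd (inv_letter i b)) (M (i, b) (snd (inv_letter i b)) x) = x" for b x
    using M_mult[of "(i, b)" "snd (inv_letter i b)" "snd (inv_letter i b)" x] inv_letter[OF False, of b]
      M_one[of "(i, b)"] assms(1) by simp
  then have "word_map M [inv_letter i b, inv_letter i c] (word_map M [inv_letter i c, inv_letter i b] x) = x"
    for b c x
    by (simp add: inv_letter_def)
  moreover have "exponent i (g \<otimes>\<^bsub>H i\<^esub> h) = exponent i g + exponent i h"
    using hom_mult[OF exponent(1)[OF assms(1) False] assms(2,3)] by simp
  ultimately show ?thesis
    using False by (simp add: expand_def word_map_alternating cyclic_map_add del: word_map_simps)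
qed

lemma word_map_expand_one:
  assumes "i \<in> I"
  shows "word_map M (expand i \<one>\<^bsub>H i\<^esub>) x = x"
proof (cases "finite (carrier (H i))")
  case True
  then show ?thesis using assms M_one[of "(i, False)"] by (simp add: expand_def K_def)
next
  case False
  then show ?thesis using exponent(3)[OF assms False] by (simp add: expand_def alternating_def)
qed

lemma word_map_expand_word:
  "word_map M (expand_word w) x = word_map (\<lambda>i h. word_map M (expand i h)) w x"
  by (induction w) (auto simp: split_paired_all)

text \<open>The expansions of the letters of one factor already satisfy its group laws as maps, so
  the free product acts without any comparison of expanded words.\<close>

lemma word_map_free_product:
  assumes "reduced_word I H v" "reduced_word I H w"
  shows "word_map M (expand_word (v \<otimes>\<^bsub>free_product I H\<^esub> w)) x
    = word_map M (expand_word v) (word_map M (expand_word w) x)"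
proof -
  have "set v \<subseteq> (SIGMA i:I. carrier (H i))" "set w \<subseteq> (SIGMA i:I. carrier (H i))"
    using assms by (auto simp: reduced_word_def)
  then show ?thesis
    unfolding word_map_expand_word free_product_def monoid.simps
    by (intro word_map_foldr_cons_red[where I = I])
      (auto simp: grp word_map_expand_mult word_map_expand_one)
qed

end

end

section \<open>The embedding\<close>

lemma wreath_product_free_product_embeds:
  fixes I :: "'i set" and H :: "'i \<Rightarrow> 'g monoid" and G :: "'h monoid" and A :: "'a monoid"
    and S :: "'b set"
  assumes "countable I"
    and "\<And>i. i \<in> I \<Longrightarrow> group (H i)"
    and "\<And>i. i \<in> I \<Longrightarrow> finite (carrier (H i)) \<or> H i \<cong> integer_group"
    and G: "group G" "G \<cong> free_product I H"
    and A: "comm_group A" "finite (carrier A)"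
    and S: "finite S" "card S \<ge> 2"
  shows "embeds_in (wreath_product A G) (topological_full_group S)"
proof -
  interpret G: group G by fact
  interpret finite_or_cyclic I H by (rule finite_or_cyclic.intro) (use assms in auto)
  obtain s z where sz: "s \<in> S" "z \<in> S" "z \<noteq> s"
    using S card_le_Suc0_iff_eq[OF S(1)] by auto
  have "countable (I \<times> (UNIV :: bool set))" using assms(1) by simp
  then have "\<exists>N e len \<iota>. tape A N e (I \<times> UNIV) K len \<iota>"
    by (rule ex_tape[OF A]) (simp_all only: K)
  then obtain N e len \<iota> where "tape A N e (I \<times> UNIV) K len \<iota>"
    by (elim exE)
  then interpret tape A s N e "I \<times> UNIV" K len \<iota> .
  obtain \<psi> where \<psi>: "\<psi> \<in> hom G (free_product I H)" "inj_on \<psi> (carrier G)"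
    "\<psi> ` carrier G = carrier (free_product I H)"
    using G(2) by (auto simp: is_iso_def iso_def bij_betw_def)
  have red: "reduced_word I H (\<psi> g)" if "g \<in> carrier G" for g
    using hom_in_carrier[OF \<psi>(1) that] by (simp add: free_product_def)
  have red': "reduced_word (I \<times> UNIV) K (expand_word (\<psi> g))" if "g \<in> carrier G" for g
    using reduced_expand_word red that by blast
  define \<phi> where "\<phi> g = word_act (expand_word (\<psi> g))" for g
  have wm: "word_act w = word_map move w" for w
    by (simp add: word_act_def word_map_def fun_eq_iff)
  have \<phi>_mult: "\<phi> (g \<otimes>\<^bsub>G\<^esub> h) x = \<phi> g (\<phi> h x)" if "g \<in> carrier G" "h \<in> carrier G" for g h x
    unfolding \<phi>_def wm hom_mult[OF \<psi>(1) that]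
    by (rule word_map_free_product) (auto simp: move_mult move_one red that)
  \<comment> \<open>An element \<open>u\<close> with \<open>\<psi> u = []\<close> acts trivially,
    and multiplicativity at \<open>\<one>\<close> and \<open>u\<close> then makes
    \<open>\<one>\<close> act trivially as well.\<close>
  have \<phi>_one: "\<phi> \<one>\<^bsub>G\<^esub> x = x" for x
  proof -
    have "[] \<in> carrier (free_product I H)" by (simp add: free_product_def reduced_word_def)
    then obtain u where "u \<in> carrier G" "\<psi> u = []" using \<psi>(3) by (metis imageE)
    then show ?thesis using \<phi>_mult[of "\<one>\<^bsub>G\<^esub>" u x] by (simp add: \<phi>_def word_act_def)
  qed
  have "wreath_action A G lamp \<phi> target S"
  proof (intro wreath_action.intro wreath_action_axioms.intro A G(1))
    show "shift_map (\<phi> g)" if "g \<in> carrier G" for g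
      unfolding \<phi>_def using red'[OF that]
      by (intro shift_map_word_act) (auto simp: reduced_word_def)
    show "\<phi> g (lamp a x) = lamp a (\<phi> g x)" if "a \<in> carrier A" "g \<in> carrier G" for a g x
      unfolding \<phi>_def using red'[OF that(2)] that(1)
      by (intro word_act_lamp) (auto simp: reduced_word_def)
    fix F assume F: "finite F" "F \<subseteq> carrier G" "F \<noteq> {}"
    let ?w = "\<lambda>h. expand_word (\<psi> (inv\<^bsub>G\<^esub> h))"
    have w: "h = k" if "h \<in> F" "k \<in> F" "?w h = ?w k" for h k
    proof -
      have hk: "inv\<^bsub>G\<^esub> h \<in> carrier G" "inv\<^bsub>G\<^esub> k \<in> carrier G" using that F by auto
      then have "\<psi> (inv\<^bsub>G\<^esub> h) = \<psi> (inv\<^bsub>G\<^esub> k)" using expand_word_inj red that(3) by blast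
      then have "inv\<^bsub>G\<^esub> h = inv\<^bsub>G\<^esub> k" using \<psi>(2) hk by (auto simp: inj_on_def)
      then show ?thesis using that F by (metis G.inv_inv subsetD)
    qed
    have fin: "finite (?w ` F)" and ne: "?w ` F \<noteq> {}" using F by auto
    have rd: "\<forall>v\<in>?w ` F. reduced_word (I \<times> UNIV) K v"
      using F(2) red' by auto
    obtain x where x: "\<forall>i. x i \<in> {s, z}"
      "\<exists>v\<in>?w ` F. word_act v x \<in> target \<and> (\<forall>u\<in>?w ` F. word_act u x \<in> target \<longrightarrow> u = v)"
      "\<forall>a\<in>carrier A. lamp a x = x \<longrightarrow> a = \<one>\<^bsub>A\<^esub>"
      using separating_point[OF fin ne rd sz(3)] by (elim exE conjE) (rule that)
    then obtain h where h: "h \<in> F" "word_act (?w h) x \<in> target"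
      "\<forall>k\<in>F. word_act (?w k) x \<in> target \<longrightarrow> ?w k = ?w h" by auto
    have "x \<in> topspace (full_shift S)" using x(1) sz by (auto simp: topspace_full_shift)
    then show "\<exists>x\<in>topspace (full_shift S). \<exists>h\<in>F. \<phi> (inv\<^bsub>G\<^esub> h) x \<in> target \<and>
        (\<forall>k\<in>F. \<phi> (inv\<^bsub>G\<^esub> k) x \<in> target \<longrightarrow> k = h) \<and> (\<forall>a\<in>carrier A. lamp a x = x \<longrightarrow> a = \<one>\<^bsub>A\<^esub>)"
      unfolding \<phi>_def using h x(3) w by blast
  qed (simp_all add: lamps.shift_map_act lamps.act_mult lamps.act_one \<phi>_mult \<phi>_one is_local_target target_lamp)
  then show ?thesis by (rule wreath_action.wreath_product_embeds)
qed

lemma integer_group_iso_free_product: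
  "integer_group \<cong> free_product {()} (\<lambda>_. integer_group)"
proof -
  define h where "h n = (if n = 0 then [] else [((), n)])" for n :: int
  have "h \<in> iso integer_group (free_product {()} (\<lambda>_. integer_group))"
    unfolding iso_def
  proof (intro CollectI conjI homI)
    show "h n \<in> carrier (free_product {()} (\<lambda>_. integer_group))" for n
      by (simp add: h_def free_product_def reduced_word_def)
    show "h (m \<otimes>\<^bsub>integer_group\<^esub> n) = h m \<otimes>\<^bsub>free_product {()} (\<lambda>_. integer_group)\<^esub> h n" for m n
      by (auto simp: h_def free_product_def Let_def)
    have "w \<in> range h" if "reduced_word {()} (\<lambda>_. integer_group) w" for w
    proof (cases w)
      case Nil
      then show ?thesis by (auto simp: h_def intro: range_eqI[of _ _ 0])
    next
      case (Cons y v)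
      have "v = []" using that Cons by (cases v) (auto simp: reduced_word_iff)
      then show ?thesis using that Cons
        by (cases y) (auto simp: h_def reduced_word_iff intro!: range_eqI[of _ _ "snd y"])
    qed
    moreover have "inj h" by (auto simp: h_def inj_on_def split: if_splits)
    ultimately show "bij_betw h (carrier integer_group) (carrier (free_product {()} (\<lambda>_. integer_group)))"
      by (auto simp: bij_betw_def free_product_def h_def reduced_word_def)
  qed
  then show ?thesis by (auto simp: is_iso_def)
qed

theorem mainTheorem14:
  fixes I :: "'i set" and H :: "'i \<Rightarrow> 'g monoid" and G :: "'h monoid"
    and A :: "'a monoid" and S :: "'b set"
  assumes "countable I"
    and "\<And>i. i \<in> I \<Longrightarrow> group (H i)"
    and "\<And>i. i \<in> I \<Longrightarrow> finite (carrier (H i)) \<or> H i \<cong> integer_group"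
    and "group G" and "G \<cong> free_product I H"
    and "comm_group A" and "finite (carrier A)"
    and "finite S" and "card S \<ge> 2"
  shows "embeds_in (wreath_product A G) (topological_full_group S)
       \<and> embeds_in (wreath_product (integer_mod_group 2) integer_group) (topological_full_group S)"
proof
  show "embeds_in (wreath_product A G) (topological_full_group S)"
    by (rule wreath_product_free_product_embeds[OF assms])
  show "embeds_in (wreath_product (integer_mod_group 2) integer_group) (topological_full_group S)"
  proof (rule wreath_product_free_product_embeds[of "{()}" "\<lambda>_. integer_group"])
    show "comm_group (integer_mod_group 2)"
      by (rule group.group_comm_groupI) (simp_all add: add.commute)
    show "finite (carrier (integer_mod_group 2))" by (simp add: carrier_integer_mod_group)
  qed (use assms(8,9) integer_group_iso_free_product in \<open>auto simp: iso_refl\<close>)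
qed

end
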